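(* Let $t\ge 2$ and $n\ge 1$ be integers, let $\omega$ be a primitive $t$-th root of unity and let $X=(x_1,\dots,x_n)$ be indeterminates. Let $\lambda$ be a partition with $\ell(\lambda)\le tn+1$, and write $n_i=n_i(\lambda,tn+1)$ and $\lambda^{(i)}$ ($0\le i\le t-1$) for the beta-set data and the $t$-quotient computed with $m=tn+1$ (see context). Consider the Schur polynomial $s_\lambda$ in the $tn+1$ variables $(X,\omega X,\dots,\omega^{t-1}X,1)=(x_1,\dots,x_n,\omega x_1,\dots,\omega x_n,\dots,\omega^{t-1}x_1,\dots,\omega^{t-1}x_n,1)$. (1) If the $t$-core of $\lambda$ has length greater than $1$, then $s_\lambda(X,\omega X,\dots,\omega^{t-1}X,1)=0$. (2) If the $t$-core of $\lambda$ equals the one-row partition $(c)$ for some $0\le c\le t-1$ (with $(0)$ the empty partition), then \[ s_\lambda(X,\omega X,\dots,\omega^{t-1}X,1)=(-1)^{\frac{t(t-1)}{2}\frac{n(n+1)}{2}-cn}\,\operatorname{sgn}(\sigma^c_\lambda)\, s_{\lambda^{(c)}}(x_1^t,\dots,x_n^t,1)\prod_{i\ne c,\,0\le i\le t-1} s_{\lambda^{(i)}}(x_1^t,\dots,x_n^t). \]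
   Context: For a sequence $\mu=(\mu_1,\dots,\mu_N)$ of nonnegative integers with $\mu_1\ge\dots\ge\mu_N$, the Schur polynomial in $N$ variables is $s_\mu(y_1,\dots,y_N)=\det(y_i^{\mu_j+N-j})_{i,j=1}^N/\det(y_i^{N-j})_{i,j=1}^N$ (for a partition with fewer than $N$ nonzero parts, pad with zeros). For a partition $\lambda$ with $\ell(\lambda)\le m$, its beta set is $\beta(\lambda,m)=(\beta_1,\dots,\beta_m)$ with $\beta_j=\lambda_j+m-j$. For $0\le i\le t-1$, $n_i(\lambda,m)$ is the number of entries of $\beta(\lambda,m)$ congruent to $i$ modulo $t$. The entries congruent to $i$ are written in decreasing order as $t\tilde\beta^{(i)}_1+i>\dots>t\tilde\beta^{(i)}_{n_i}+i$, and $\lambda^{(i)}$ is the partition with $n_i(\lambda,m)$ parts (some possibly zero) given by $\lambda^{(i)}_j=\tilde\beta^{(i)}_j-n_i(\lambda,m)+j$; the $t$-quotient is $(\lambda^{(0)},\dots,\lambda^{(t-1)})$. The $t$-core of $\lambda$ is the partition obtained by successively removing border strips (connected skew shapes containing no $2\times2$ square) of size $t$ from the Young diagram of $\lambda$ until no more can be removed; it is independent of choices. The permutation $\sigma^c_\lambda\in S_{tn+1}$ is defined by requiring that $(\beta_{\sigma^c_\lambda(1)},\dots,\beta_{\sigma^c_\lambda(tn+1)})$ (with $\beta=\beta(\lambda,tn+1)$) lists first the $n_c$ entries congruent to $c$ mod $t$ in decreasing order, then the entries congruent to $0$ in decreasing order, then those congruent to $1$, and so on up to $t-1$, skipping the residue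 $c$. *)

theory Defs
  imports
    "Jordan_Normal_Form.Determinant"
    "HOL-Library.Poly_Mapping"
    "HOL-Computational_Algebra.Fraction_Field"
    "HOL-Combinatorics.Permutations"
begin

text \<open>
  All indices (parts of partitions, variables, matrix rows and columns) start at 0, so
  the exponent \<open>\<mu>\<^sub>j + N - j\<close> of the usual 1-based notation reads \<open>\<mu> j + (N - 1 - j)\<close>.
\<close>

section \<open>Partitions and cores\<close>

text \<open>A partition is the sequence of its parts, padded with infinitely many zeros.\<close>

definition is_partition :: "(nat \<Rightarrow> nat) \<Rightarrow> bool" where
  "is_partition lam \<longleftrightarrow> antimono lam \<and> finite {i. lam i \<noteq> 0}"

definition part_length :: "(nat \<Rightarrow> nat) \<Rightarrow> nat" where
  "part_length lam = card {i. lam i \<noteq> 0}"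

definition one_row :: "nat \<Rightarrow> nat \<Rightarrow> nat" where
  "one_row c = (\<lambda>i. if i = 0 then c else 0)"

definition young_diagram :: "(nat \<Rightarrow> nat) \<Rightarrow> (nat \<times> nat) set" where
  "young_diagram lam = {(i, j). j < lam i}"

definition adjacent :: "nat \<times> nat \<Rightarrow> nat \<times> nat \<Rightarrow> bool" where
  "adjacent p q \<longleftrightarrow>
     (fst p = fst q \<and> (snd p = Suc (snd q) \<or> snd q = Suc (snd p))) \<or>
     (snd p = snd q \<and> (fst p = Suc (fst q) \<or> fst q = Suc (fst p)))"

definition connected_cells :: "(nat \<times> nat) set \<Rightarrow> bool" where
  "connected_cells S \<longleftrightarrow>
     (\<forall>p\<in>S. \<forall>q\<in>S. (p, q) \<in> {(a, b). a \<in> S \<and> b \<in> S \<and> adjacent a b}\<^sup>*)"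

definition contains_2x2 :: "(nat \<times> nat) set \<Rightarrow> bool" where
  "contains_2x2 S \<longleftrightarrow>
     (\<exists>i j. {(i, j), (Suc i, j), (i, Suc j), (Suc i, Suc j)} \<subseteq> S)"

definition remove_border_strip :: "nat \<Rightarrow> (nat \<Rightarrow> nat) \<Rightarrow> (nat \<Rightarrow> nat) \<Rightarrow> bool" where
  "remove_border_strip t lam mu \<longleftrightarrow>
     is_partition lam \<and> is_partition mu \<and> young_diagram mu \<subseteq> young_diagram lam \<and>
     (let S = young_diagram lam - young_diagram mu
      in card S = t \<and> connected_cells S \<and> \<not> contains_2x2 S)"

definition t_core :: "nat \<Rightarrow> (nat \<Rightarrow> nat) \<Rightarrow> nat \<Rightarrow> nat" where
  "t_core t lam =
     (THE kap. (remove_border_strip t)\<^sup>*\<^sup>* lam kap \<and> (\<nexists>mu. remove_border_strip t kap mu))"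


section \<open>Beta sets, quotients and the sorting permutation\<close>

definition beta_set :: "(nat \<Rightarrow> nat) \<Rightarrow> nat \<Rightarrow> nat list" where
  "beta_set lam m = map (\<lambda>j. lam j + (m - 1 - j)) [0..<m]"

text \<open>Beta sets of partitions are strictly decreasing, hence so are the residue classes.\<close>

definition beta_residue :: "nat \<Rightarrow> (nat \<Rightarrow> nat) \<Rightarrow> nat \<Rightarrow> nat \<Rightarrow> nat list" where
  "beta_residue t lam m i = filter (\<lambda>b. b mod t = i) (beta_set lam m)"

definition residue_count :: "nat \<Rightarrow> (nat \<Rightarrow> nat) \<Rightarrow> nat \<Rightarrow> nat \<Rightarrow> nat" where
  "residue_count t lam m i = length (beta_residue t lam m i)"

text \<open>
  The 1-based \<open>\<lambda>\<^sup>(\<^sup>i\<^sup>)\<^sub>j = \<beta>\<^sub>j - n\<^sub>i + j\<close>, where \<open>\<beta>\<^sub>j\<close> is the \<open>j\<close>-th entry of the residue class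
  divided by \<open>t\<close>. The subtraction comes last and never truncates, because
  the quotients are strictly decreasing, so that \<open>\<beta>\<^sub>j \<ge> n\<^sub>i - j\<close>.
\<close>

definition t_quotient :: "nat \<Rightarrow> (nat \<Rightarrow> nat) \<Rightarrow> nat \<Rightarrow> nat \<Rightarrow> nat \<Rightarrow> nat" where
  "t_quotient t lam m i =
     (\<lambda>j. if j < residue_count t lam m i
           then (beta_residue t lam m i ! j) div t + (j + 1) - residue_count t lam m i
           else 0)"

definition sort_perm :: "nat \<Rightarrow> (nat \<Rightarrow> nat) \<Rightarrow> nat \<Rightarrow> nat \<Rightarrow> nat \<Rightarrow> nat" where
  "sort_perm t lam m c =
     (THE p. p permutes {0..<m} \<and>
        map (\<lambda>k. beta_set lam m ! p k) [0..<m] =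
        concat (map (beta_residue t lam m) (c # filter (\<lambda>i. i \<noteq> c) [0..<t])))"


section \<open>Schur polynomials\<close>

text \<open>
  The number of variables is the length of the list. The quotient is meaningful
  when the variables are pairwise distinct, so that the denominator does not vanish.
\<close>

definition schur :: "(nat \<Rightarrow> nat) \<Rightarrow> 'a :: field list \<Rightarrow> 'a" where
  "schur mu ys =
     (let N = length ys
      in det (mat N N (\<lambda>(i, j). (ys ! i) ^ (mu j + (N - 1 - j)))) /
         det (mat N N (\<lambda>(i, j). (ys ! i) ^ (N - 1 - j))))"

text \<open>
  Polynomials over the complex numbers in indeterminates indexed by the naturals
  (maps from exponent vectors to coefficients), and their field of fractions.
\<close>

type_synonym ratfun = "((nat \<Rightarrow>\<^sub>0 nat) \<Rightarrow>\<^sub>0 complex) fract"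

definition const :: "complex \<Rightarrow> ratfun" where
  "const a = Fract (Poly_Mapping.single 0 a) 1"

definition indet :: "nat \<Rightarrow> ratfun" where
  "indet i = Fract (Poly_Mapping.single (Poly_Mapping.single i 1) 1) 1"

definition indets :: "nat \<Rightarrow> ratfun list" where
  "indets n = map indet [0..<n]"

definition primitive_root_of_unity :: "nat \<Rightarrow> 'a :: field \<Rightarrow> bool" where
  "primitive_root_of_unity t w \<longleftrightarrow> w ^ t = 1 \<and> (\<forall>k. 0 < k \<and> k < t \<longrightarrow> w ^ k \<noteq> 1)"

text \<open>The list \<open>(X, \<omega>X, \<dots>, \<omega>\<^sup>t\<^sup>-\<^sup>1X)\<close>.\<close>

definition twisted_indets :: "nat \<Rightarrow> nat \<Rightarrow> complex \<Rightarrow> ratfun list" where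
  "twisted_indets t n w = concat (map (\<lambda>k. map (\<lambda>x. const w ^ k * x) (indets n)) [0..<t])"


section \<open>The denominators do not vanish\<close>

lemma schur_denominator_nonzero:
  fixes ys :: "'a :: field list"
  assumes "distinct ys"
  shows "det (mat (length ys) (length ys) (\<lambda>(i, j). (ys ! i) ^ (length ys - 1 - j))) \<noteq> 0"
proof
  define N where "N = length ys"
  define A where "A = mat N N (\<lambda>(i, j). (ys ! i) ^ (N - 1 - j))"
  have A: "A \<in> carrier_mat N N" by (simp add: A_def)
  assume "det (mat (length ys) (length ys) (\<lambda>(i, j). (ys ! i) ^ (length ys - 1 - j))) = 0"
  then have "det A = 0" by (simp add: A_def N_def)
  then obtain v where v: "v \<in> carrier_vec N" "v \<noteq> 0\<^sub>v N" "A *\<^sub>v v = 0\<^sub>v N"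
    using det_0_iff_vec_prod_zero_field[OF A] by blast
  define p where "p = (\<Sum>j<N. monom (v $ j) (N - 1 - j))"
  have root: "poly p (ys ! i) = 0" if "i < N" for i
  proof -
    have "(A *\<^sub>v v) $ i = (\<Sum>j<N. (ys ! i) ^ (N - 1 - j) * v $ j)"
      using that v(1) by (auto simp: A_def scalar_prod_def lessThan_atLeast0 intro!: sum.cong)
    then show ?thesis
      using v(3) that by (simp add: p_def poly_sum poly_monom mult.commute)
  qed
  have co: "coeff p (N - 1 - k) = v $ k" if "k < N" for k
  proof -
    have "coeff p (N - 1 - k) = (\<Sum>j<N. if j = k then v $ j else 0)"
      unfolding p_def coeff_sum coeff_monom using that by (intro sum.cong) auto
    then show ?thesis using that by simp
  qed
  have "p \<noteq> 0"
  proof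
    assume "p = 0"
    then have "v = 0\<^sub>v N" using co v(1) by (intro eq_vecI) auto
    with v(2) show False by simp
  qed
  have "N > 0" using v(1,2) by (cases N) auto
  have "degree p \<le> N - 1"
    unfolding p_def by (intro degree_sum_le) (auto intro: order_trans[OF degree_monom_le])
  moreover have "set ys \<subseteq> {x. poly p x = 0}"
    using root by (auto simp: N_def in_set_conv_nth)
  then have "card (set ys) \<le> card {x. poly p x = 0}"
    by (intro card_mono poly_roots_finite \<open>p \<noteq> 0\<close>)
  moreover have "card {x. poly p x = 0} \<le> degree p"
    by (rule card_poly_roots_bound[OF \<open>p \<noteq> 0\<close>])
  ultimately show False
    using \<open>N > 0\<close> distinct_card[OF assms] unfolding N_def by linarith
qed

lemma Fract_power_1: "Fract (a :: 'a :: idom) 1 ^ k = Fract (a ^ k) 1"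
  by (induction k) (simp_all add: One_fract_def)

lemma const_power: "const a ^ k = const (a ^ k)"
proof -
  have "Poly_Mapping.single (0 :: nat \<Rightarrow>\<^sub>0 nat) a ^ k = Poly_Mapping.single 0 (a ^ k)"
    by (induction k) (simp_all add: mult_single)
  then show ?thesis by (simp add: const_def Fract_power_1)
qed

lemma const_mult_indet:
  "const a * indet i = Fract (Poly_Mapping.single (Poly_Mapping.single i 1) a) 1"
  by (simp add: const_def indet_def mult_single)

lemma indet_power:
  "indet i ^ t = Fract (Poly_Mapping.single (Poly_Mapping.single i t) 1) 1"
proof -
  have "Poly_Mapping.single (Poly_Mapping.single i (1::nat)) (1::complex) ^ t =
        Poly_Mapping.single (Poly_Mapping.single i t) 1"
    by (induction t) (simp_all add: mult_single single_add[symmetric])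
  then show ?thesis by (simp add: indet_def Fract_power_1)
qed

lemma single_eq_single_iff:
  "Poly_Mapping.single k (a :: 'a :: zero) = Poly_Mapping.single l b \<longleftrightarrow> (k = l \<and> a = b) \<or> (a = 0 \<and> b = 0)"
  by (metis lookup_single_eq lookup_single_not_eq single_zero)

lemma single_eq_0_iff: "Poly_Mapping.single k (a :: 'a :: zero) = 0 \<longleftrightarrow> a = 0"
  by (metis lookup_single_eq lookup_zero single_zero)

lemma Fract_1_eq_iff: "Fract (a :: 'a :: idom) 1 = Fract b 1 \<longleftrightarrow> a = b"
  by (simp add: eq_fract)

lemma one_ratfun: "(1 :: ratfun) = Fract (Poly_Mapping.single 0 1) 1"
  by (simp add: One_fract_def)

lemma distinct_powers:
  assumes "t \<ge> 1"
  shows "distinct (map (\<lambda>x. x ^ t) (indets n) @ [1])"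
proof -
  have z: "Poly_Mapping.single i t \<noteq> 0" for i :: nat
    using assms by (simp add: single_eq_0_iff)
  have "x = y" if "indet x ^ t = indet y ^ t" for x y
    using that assms by (simp add: indet_power Fract_1_eq_iff single_eq_single_iff)
  moreover have "indet x ^ t \<noteq> 1" for x
    using z unfolding indet_power one_ratfun Fract_1_eq_iff single_eq_single_iff by simp
  ultimately show ?thesis
    by (auto simp: indets_def distinct_map inj_on_def)
qed

lemma distinct_twisted:
  assumes "primitive_root_of_unity t w" "t \<ge> 1"
  shows "distinct (twisted_indets t n w @ [1])"
proof -
  define f where "f = (\<lambda>(k, i). const w ^ k * indet i)"
  have tw: "twisted_indets t n w = map f (List.product [0..<t] [0..<n])"
    by (simp add: twisted_indets_def indets_def product_concat_map map_concat f_def o_def)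
  have f: "f (k, i) = Fract (Poly_Mapping.single (Poly_Mapping.single i 1) (w ^ k)) 1" for k i
    by (simp only: f_def const_power const_mult_indet prod.case)
  have "w \<noteq> 0"
    using assms by (auto simp: primitive_root_of_unity_def power_0_left split: if_splits)
  have less: "w ^ j \<noteq> w ^ k" if "j < k" "k < t" for j k
  proof
    assume "w ^ j = w ^ k"
    also have "\<dots> = w ^ j * w ^ (k - j)"
      using that by (simp add: power_add[symmetric])
    finally have "w ^ (k - j) = 1" using \<open>w \<noteq> 0\<close> by simp
    moreover have "0 < k - j" "k - j < t" using that by auto
    ultimately show False using assms(1) by (auto simp: primitive_root_of_unity_def)
  qed
  have "inj_on f (set (List.product [0..<t] [0..<n]))"
  proof (rule inj_onI, clarsimp)
    fix k i k' i'
    assume "k < t" "k' < t" "f (k, i) = f (k', i')"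
    then have "i = i'" "w ^ k = w ^ k'"
      using \<open>w \<noteq> 0\<close> unfolding f Fract_1_eq_iff single_eq_single_iff by auto
    moreover have "k = k'"
      using less[of k k'] less[of k' k] \<open>k < t\<close> \<open>k' < t\<close> \<open>w ^ k = w ^ k'\<close>
      by (metis linorder_neqE_nat)
    ultimately show "k = k' \<and> i = i'" by simp
  qed
  moreover have "1 \<noteq> f (k, i)" for k i
    unfolding f one_ratfun Fract_1_eq_iff single_eq_single_iff by (simp add: single_eq_0_iff)
  ultimately show ?thesis
    unfolding tw by (auto simp: distinct_map distinct_product)
qed

end

theory Submission
  imports Defs
begin

text \<open>
  The rows of the numerator matrix belonging to \<open>X, \<omega>X, \<dots>, \<omega>\<^sup>t\<^sup>-\<^sup>1X\<close> factor through a discrete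
  Fourier transform: the matrix is \<open>W B\<close>, where \<open>W\<close> does not depend on the partition, and
  row \<open>(r, i)\<close> of \<open>B\<close> has entry \<open>x\<^sub>i\<^sup>\<beta>\<close> in the columns with \<open>\<beta> \<equiv> r (mod t)\<close> and \<open>0\<close> elsewhere. Hence \<open>W\<close>
  cancels against the Vandermonde denominator, which is the same matrix for the empty partition.
  If some residue class \<open>r\<close> has fewer than \<open>n\<close> columns, then \<open>det B = 0\<close>. Otherwise exactly one
  class \<open>c\<close> has \<open>n + 1\<close> columns, and after sorting the columns by residue and moving
  the rows of class \<open>c\<close> and the row of ones to the top, \<open>B\<close> is block triangular with
  the numerators of the Schur polynomials of the quotient on the diagonal.

  Removing a border strip of size \<open>t\<close> telescopes, over the contents of its cells, to the
  replacement of one beta number \<open>b + t\<close> by \<open>b\<close>. So the residue counts are invariant, and they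
  determine the core, whose beta set contains \<open>b - t\<close> along with every \<open>b \<ge> t\<close>. The core is \<open>(c)\<close>
  exactly when class \<open>c\<close> has \<open>n + 1\<close> elements and all the others have \<open>n\<close>.
\<close>

section \<open>Beta sets and cores\<close>

lemma partition_antimono: "is_partition lam \<Longrightarrow> i \<le> j \<Longrightarrow> lam j \<le> lam i"
  by (auto simp: is_partition_def antimono_def)

lemma partition_eq_0:
  assumes "is_partition lam" "part_length lam \<le> m" "m \<le> i"
  shows "lam i = 0"
proof (rule ccontr)
  assume "lam i \<noteq> 0"
  then have "{..i} \<subseteq> {i. lam i \<noteq> 0}"
    using partition_antimono[OF assms(1)] by fastforce
  then have "card {..i} \<le> part_length lam"
    unfolding part_length_def using assms(1) by (intro card_mono) (auto simp: is_partition_def)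
  with assms show False by simp
qed

text \<open>
  The content of a cell, shifted so that adding the cell to the end of its row replaces the
  beta number \<open>cell_pos m p\<close> of that row by its successor.
\<close>

definition cell_pos :: "nat \<Rightarrow> nat \<times> nat \<Rightarrow> nat" where
  "cell_pos m p = snd p + (m - 1 - fst p)"

section \<open>Border strips and the contents of their cells\<close>

lemma young_diagram_Sigma:
  assumes "\<forall>i\<ge>m. lam i = 0"
  shows "young_diagram lam = Sigma {..<m} (\<lambda>i. {..<lam i})"
proof -
  have "i < m" if "k < lam i" for i k
    using that assms by (cases "i < m") auto
  then show ?thesis by (auto simp: young_diagram_def)
qed

text \<open>Row i telescopes from the beta number m - 1 - i of an empty row, one cell at a time. The
  arbitrary \<open>f\<close> acts as a test function: it compares beta numbers as a multiset,
  without tracking which row holds which of them.\<close>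

lemma sum_beta_eq_sum_cells:
  fixes f :: "nat \<Rightarrow> int"
  assumes "\<forall>i\<ge>m. lam i = 0"
  shows "(\<Sum>j<m. f (lam j + (m - 1 - j))) =
    (\<Sum>j<m. f (m - 1 - j)) + (\<Sum>p\<in>young_diagram lam. f (Suc (cell_pos m p)) - f (cell_pos m p))"
proof -
  have "(\<Sum>p\<in>young_diagram lam. f (Suc (cell_pos m p)) - f (cell_pos m p)) =
    (\<Sum>i<m. \<Sum>k<lam i. f (Suc k + (m - 1 - i)) - f (k + (m - 1 - i)))"
    unfolding young_diagram_Sigma[OF assms]
    by (subst sum.Sigma) (auto simp: cell_pos_def intro!: sum.cong)
  also have "\<dots> = (\<Sum>i<m. f (lam i + (m - 1 - i)) - f (m - 1 - i))"
    by (intro sum.cong refl)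
      (subst sum_lessThan_telescope[where f = "\<lambda>k. f (k + _)"], simp)
  finally show ?thesis by (simp add: sum_subtractf)
qed

text \<open>Two cells on one diagonal of a skew shape enclose cells that also lie in the shape,
  since both row lengths are antitone. In particular the 2 x 2 square with the upper of the two
  cells as its corner is contained in it.\<close>

lemma skew_cells_distinct_pos:
  assumes "is_partition lam" "is_partition mu" "\<forall>i\<ge>m. lam i = 0"
    and S: "S = young_diagram lam - young_diagram mu" and "\<not> contains_2x2 S"
  shows "inj_on (cell_pos m) S"
proof -
  have no: False if "(i, k) \<in> S" "(i', k') \<in> S" "i < i'" "cell_pos m (i, k) = cell_pos m (i', k')"
    for i k i' k'
  proof -
    have "i' < m" using that(2) assms(3) by (cases "i' < m") (auto simp: S young_diagram_def)
    then have k': "k' = k + (i' - i)" using that(3,4) by (simp add: cell_pos_def)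
    have "k' < lam i'" "mu i \<le> k" using that by (auto simp: S young_diagram_def)
    moreover have "lam i' \<le> lam (Suc i)" "lam (Suc i) \<le> lam i" "mu (Suc i) \<le> mu i"
      using that(3) assms(1,2) by (auto intro: partition_antimono)
    ultimately have "{(i, k), (Suc i, k), (i, Suc k), (Suc i, Suc k)} \<subseteq> S"
      using k' that(3) by (auto simp: S young_diagram_def)
    with assms(5) show False by (auto simp: contains_2x2_def)
  qed
  show ?thesis
  proof (rule inj_onI, clarify)
    fix i k i' k'
    assume *: "(i, k) \<in> S" "(i', k') \<in> S" "cell_pos m (i, k) = cell_pos m (i', k')"
    then have "i = i'" using no[of i k i' k'] no[of i' k' i k] by (metis linorder_neqE_nat)
    with * show "i = i' \<and> k = k'" by (simp add: cell_pos_def)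
  qed
qed

text \<open>A step between adjacent cells changes the position by exactly one, so a path from
  \<open>p\<close> to \<open>q\<close> cannot jump over an intermediate value. The bound i < m keeps
  the subtraction in \<open>cell_pos\<close> from truncating.\<close>

lemma connected_cells_pos_convex:
  assumes "connected_cells S" "\<And>i k. (i, k) \<in> S \<Longrightarrow> i < m"
    and "p \<in> S" "q \<in> S" "cell_pos m p \<le> z" "z \<le> cell_pos m q"
  shows "z \<in> cell_pos m ` S"
proof -
  let ?R = "{(a, b). a \<in> S \<and> b \<in> S \<and> adjacent a b}"
  have "(p, q) \<in> ?R\<^sup>*" using assms by (auto simp: connected_cells_def)
  then show ?thesis using assms(6)
  proof (induction)
    case base
    then show ?case using assms(3,5) by (intro image_eqI[of _ _ p]) auto
  next
    case (step b c)
    then have "b \<in> S" "c \<in> S" "adjacent b c" by auto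
    then have "cell_pos m c \<le> Suc (cell_pos m b)"
      using assms(2)[of "fst b" "snd b"] assms(2)[of "fst c" "snd c"]
      by (auto simp: adjacent_def cell_pos_def)
    then show ?case using step by (cases "z \<le> cell_pos m b") (auto simp: not_le intro!: image_eqI[of _ _ c])
  qed
qed

lemma finite_convex_nat_interval:
  fixes A :: "nat set"
  assumes "finite A" "A \<noteq> {}" "\<And>x y z. x \<in> A \<Longrightarrow> y \<in> A \<Longrightarrow> x \<le> z \<Longrightarrow> z \<le> y \<Longrightarrow> z \<in> A"
  shows "A = {Min A..<Min A + card A}"
proof -
  define a b where "a = Min A" and "b = Max A"
  have "a \<in> A" "b \<in> A" "a \<le> b" using assms(1,2) by (auto simp: a_def b_def)
  have "A \<subseteq> {a..b}" using assms(1) by (auto simp: a_def b_def)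
  moreover have "{a..b} \<subseteq> A" using assms(3)[OF \<open>a \<in> A\<close> \<open>b \<in> A\<close>] by auto
  ultimately have A: "A = {a..b}" by (rule equalityI)
  have "{a..b} = {a..<a + card {a..b}}" using \<open>a \<le> b\<close> by auto
  then have "A = {a..<a + card A}" unfolding A .
  then show ?thesis unfolding a_def .
qed

text \<open>The positions in a strip are distinct and convex, hence form an interval of length t,
  over which the differences of \<open>f\<close> telescope. With \<open>f\<close> arbitrary this
  says that one beta number a of \<open>mu\<close> becomes a + t in \<open>lam\<close>.\<close>

lemma remove_border_strip_sum:
  fixes f :: "nat \<Rightarrow> int"
  assumes "remove_border_strip t lam mu" "t > 0" "\<forall>i\<ge>m. lam i = 0"
  shows "\<exists>a. (\<Sum>j<m. f (lam j + (m - 1 - j))) = (\<Sum>j<m. f (mu j + (m - 1 - j))) + (f (a + t) - f a)"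
proof -
  define S where "S = young_diagram lam - young_diagram mu"
  have r: "is_partition lam" "is_partition mu" "young_diagram mu \<subseteq> young_diagram lam"
    "card S = t" "connected_cells S" "\<not> contains_2x2 S"
    using assms(1) by (auto simp: remove_border_strip_def S_def Let_def)
  have mu0: "\<forall>i\<ge>m. mu i = 0"
    using r(3) assms(3) by (fastforce simp: young_diagram_def subset_iff)
  have fin: "finite (young_diagram lam)" using young_diagram_Sigma[OF assms(3)] by simp
  have m: "i < m" if "(i, k) \<in> S" for i k
    using that assms(3) by (cases "i < m") (auto simp: S_def young_diagram_def)
  have inj: "inj_on (cell_pos m) S"
    using skew_cells_distinct_pos[OF r(1,2) assms(3) S_def r(6)] .
  let ?g = "\<lambda>x. f (Suc x) - f x"
  define a where "a = Min (cell_pos m ` S)"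
  have "S \<noteq> {}" using r(4) assms(2) by auto
  then have "cell_pos m ` S = {a..<a + card (cell_pos m ` S)}"
    unfolding a_def using fin connected_cells_pos_convex[OF r(5) m]
    by (intro finite_convex_nat_interval) (auto simp: S_def)
  then have img: "cell_pos m ` S = {a..<a + t}" using inj r(4) by (simp add: card_image)
  have "(\<Sum>p\<in>young_diagram lam. ?g (cell_pos m p)) =
    (\<Sum>p\<in>young_diagram mu. ?g (cell_pos m p)) + (\<Sum>p\<in>S. ?g (cell_pos m p))"
    using sum.subset_diff[OF r(3) fin, of "\<lambda>p. ?g (cell_pos m p)"] by (simp add: S_def add.commute)
  also have "(\<Sum>p\<in>S. ?g (cell_pos m p)) = sum ?g (cell_pos m ` S)"
    using inj by (simp add: sum.reindex)
  also have "\<dots> = f (a + t) - f a"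
    unfolding img by (rule sum_Suc_diff') simp
  finally show ?thesis
    using sum_beta_eq_sum_cells[OF assms(3), where f = f] sum_beta_eq_sum_cells[OF mu0, where f = f] by (intro exI[of _ a]) simp
qed

lemma residue_count_eq_sum:
  "int (residue_count t lam m r) = (\<Sum>j<m. if (lam j + (m - 1 - j)) mod t = r then 1 else 0)"
proof -
  have "residue_count t lam m r = card {j. j < m \<and> (lam j + (m - 1 - j)) mod t = r}"
    by (simp add: residue_count_def beta_residue_def length_filter_conv_card beta_set_def cong: conj_cong)
  also have "int \<dots> = (\<Sum>j\<in>{j. j < m \<and> (lam j + (m - 1 - j)) mod t = r}. 1)" by simp
  also have "\<dots> = (\<Sum>j<m. if (lam j + (m - 1 - j)) mod t = r then 1 else 0)"
    by (subst sum.inter_filter[symmetric]) auto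
  finally show ?thesis .
qed

text \<open>The test function is the indicator of a residue class, which takes the same value at a
  and a + t.\<close>

lemma remove_border_strip_residue_count:
  assumes "remove_border_strip t lam mu" "t > 0" "\<forall>i\<ge>m. lam i = 0"
  shows "residue_count t mu m r = residue_count t lam m r"
proof -
  have "int (residue_count t lam m r) = int (residue_count t mu m r)"
    using remove_border_strip_sum[OF assms, where f = "\<lambda>b. if b mod t = r then 1 else 0"]
    unfolding residue_count_eq_sum by (auto simp: assms(2))
  then show ?thesis by simp
qed

lemma remove_border_strip_le:
  assumes "remove_border_strip t lam mu"
  shows "mu i \<le> lam i"
proof (rule ccontr)
  assume "\<not> mu i \<le> lam i"
  then have "(i, lam i) \<in> young_diagram mu - young_diagram lam" by (auto simp: young_diagram_def)
  with assms show False by (auto simp: remove_border_strip_def)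
qed

section \<open>Lowering a beta number by t through a border strip\<close>

lemma sym_cell_relation: "sym {(a, b). a \<in> S \<and> b \<in> S \<and> adjacent a b}"
  by (auto simp: sym_def adjacent_def)

lemma beta_strictly_decreasing:
  assumes "is_partition kap" "i < j" "j < m"
  shows "kap j + (m - 1 - j) < kap i + (m - 1 - i)"
  using partition_antimono[OF assms(1), of i j] assms(2,3) by simp

text \<open>Every cell walks left to the first cell of its row. By \<open>step\<close>, that cell
  lies directly above the last cell of the next row, so the walk goes on down to the first cell of
  row \<open>l\<close>.\<close>

lemma connected_staircase:
  assumes rows: "\<And>i k. (i, k) \<in> S \<longleftrightarrow> j \<le> i \<and> i \<le> l \<and> mu i \<le> k \<and> k < kap i"
    and ne: "\<And>i. j \<le> i \<Longrightarrow> i \<le> l \<Longrightarrow> mu i < kap i"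
    and step: "\<And>i. j \<le> i \<Longrightarrow> i < l \<Longrightarrow> mu i = kap (Suc i) - 1"
  shows "connected_cells S"
proof -
  define R where "R = {(a, b). a \<in> S \<and> b \<in> S \<and> adjacent a b}"
  have left: "((i, mu i + d), (i, mu i)) \<in> R\<^sup>*" if "(i, mu i + d) \<in> S" for i d
    using that
  proof (induction d)
    case (Suc d)
    then have "(i, mu i + d) \<in> S" by (auto simp: rows)
    moreover from this Suc.prems have "((i, mu i + Suc d), (i, mu i + d)) \<in> R"
      by (auto simp: R_def adjacent_def)
    ultimately show ?case using Suc.IH by (meson converse_rtrancl_into_rtrancl)
  qed simp
  have row_start: "((i, k), (i, mu i)) \<in> R\<^sup>*" if "(i, k) \<in> S" for i k
  proof -
    from that have "k = mu i + (k - mu i)" by (auto simp: rows)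
    with left[of i "k - mu i"] that show ?thesis by simp
  qed
  have down: "((l - d, mu (l - d)), (l, mu l)) \<in> R\<^sup>*" if "d \<le> l - j" "j \<le> l" for d
    using that
  proof (induction d)
    case (Suc d)
    define i where "i = l - Suc d"
    have i: "j \<le> i" "i < l" "Suc i = l - d" using Suc.prems by (auto simp: i_def)
    have "mu i < kap i" "mu i = kap (Suc i) - 1" "mu (Suc i) < kap (Suc i)"
      using ne[of i] ne[of "Suc i"] step[of i] i by auto
    then have "mu (Suc i) \<le> mu i" "mu i < kap (Suc i)" by linarith+
    with \<open>mu i < kap i\<close> have S: "(i, mu i) \<in> S" "(Suc i, mu i) \<in> S"
      using i(1,2) by (auto simp: rows)
    then have "((i, mu i), (Suc i, mu i)) \<in> R" by (auto simp: R_def adjacent_def)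
    also have "((Suc i, mu i), (Suc i, mu (Suc i))) \<in> R\<^sup>*" by (rule row_start[OF S(2)])
    also have "((Suc i, mu (Suc i)), (l, mu l)) \<in> R\<^sup>*"
      using Suc i by simp
    finally show ?case unfolding i_def .
  qed simp
  have root: "(p, (l, mu l)) \<in> R\<^sup>*" if "p \<in> S" for p
  proof (cases p)
    case (Pair i k)
    with that have "((i, k), (i, mu i)) \<in> R\<^sup>*" by (auto intro: row_start)
    moreover have "((i, mu i), (l, mu l)) \<in> R\<^sup>*"
      using down[of "l - i"] that Pair by (auto simp: rows)
    ultimately show ?thesis using Pair by simp
  qed
  have "sym (R\<^sup>*)" unfolding R_def by (intro sym_rtrancl sym_cell_relation)
  then show ?thesis
    unfolding connected_cells_def R_def[symmetric] by (meson root rtrancl_trans symD)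
qed

text \<open>This is the converse of the telescoping: any beta number can be lowered by t if the
  place is free. Lowering it past the beta numbers in between re-sorts the list, and the re-sorted
  list is the beta set of the shape without the strip.\<close>

lemma remove_border_strip_exists:
  assumes kap: "is_partition kap" "\<forall>i\<ge>m. kap i = 0" and "t > 0"
    and j: "j < m" and b: "b = kap j + (m - 1 - j)" "t \<le> b"
    and free: "\<forall>i<m. kap i + (m - 1 - i) \<noteq> b - t"
  shows "\<exists>mu. remove_border_strip t kap mu"
proof -
  define \<beta> where "\<beta> = (\<lambda>i. kap i + (m - 1 - i))"
  \<comment> \<open>The lowered number b - t passes every beta number of a row in \<open>K\<close>
    other than row j; it therefore ends up in the last such row, \<open>l\<close>.\<close>
  define K where "K = {i. j \<le> i \<and> i < m \<and> b - t < \<beta> i}"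
  define l where "l = Max K"
  have "j \<in> K" using j b \<open>t > 0\<close> by (auto simp: K_def \<beta>_def)
  moreover have fin: "finite K" by (auto simp: K_def)
  ultimately have "l \<in> K" unfolding l_def by (intro Max_in) auto
  then have l: "j \<le> l" "l < m" "b - t < \<beta> l" by (auto simp: K_def)
  have next_l: "\<beta> (Suc l) < b - t" if "Suc l < m"
  proof -
    have "Suc l \<notin> K" using Max_ge[OF fin, of "Suc l"] by (auto simp: l_def)
    moreover have "\<beta> (Suc l) \<noteq> b - t" using free that by (simp add: \<beta>_def)
    ultimately show ?thesis using that l by (auto simp: K_def)
  qed
  have kap_mono: "kap y \<le> kap x" if "x \<le> y" for x y
    using partition_antimono[OF kap(1) that] .
  \<comment> \<open>This serves twice: the subtraction that defines \<open>mu\<close> in row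
    \<open>l\<close> does not truncate, and the new row \<open>l\<close> is at least as long as row
    \<open>Suc l\<close>.\<close>
  have bl: "m - 1 - l + kap (Suc l) \<le> b - t"
  proof (cases "Suc l < m")
    case True
    then show ?thesis using next_l by (simp add: \<beta>_def)
  next
    case False
    then show ?thesis using kap(2) l by simp
  qed
  \<comment> \<open>Rows j to l - 1 take over the beta number of the next row. As the staircase term
    of row i is larger by one, this makes the part \<open>kap (Suc i) - 1\<close>. Row
    \<open>l\<close> receives b - t.\<close>
  define mu where "mu = (\<lambda>i. if i < j \<or> l < i then kap i
    else if i < l then kap (Suc i) - 1 else b - t - (m - 1 - l))"
  have mu_out: "mu i = kap i" if "i < j \<or> l < i" for i using that by (simp add: mu_def)
  have mu_mid: "mu i = kap (Suc i) - 1" if "j \<le> i" "i < l" for i using that by (simp add: mu_def)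
  have mu_l: "mu l = b - t - (m - 1 - l)" using l(1) by (simp add: mu_def)
  have mu_l_less: "mu l < kap l" using l(3) bl by (simp add: mu_l \<beta>_def)
  have kap_pos: "0 < kap i" if "i \<le> l" for i using kap_mono[OF that] mu_l_less by simp
  have less: "mu i < kap i" if "j \<le> i" "i \<le> l" for i
    using that mu_l_less kap_mono[of i "Suc i"] kap_pos[of i]
    by (cases "i = l") (auto simp: mu_mid)
  have le: "mu i \<le> kap i" for i
    using less[of i] mu_out[of i] by (cases "i < j \<or> l < i") auto
  have dec: "mu (Suc i) \<le> mu i" for i
  proof -
    consider "Suc i < j \<or> l < i" | "Suc i = j" | "j \<le> i" "Suc i < l" | "j \<le> i" "Suc i = l" | "i = l"
      using l(1) by linarith
    then show ?thesis
    proof cases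
      case 1
      then show ?thesis using kap_mono[of i "Suc i"] by (auto simp: mu_out)
    next
      case 2
      then show ?thesis using le[of "Suc i"] kap_mono[of i "Suc i"] by (simp add: mu_out)
    next
      case 3
      then show ?thesis using kap_mono[of "Suc i" "Suc (Suc i)"] by (simp add: mu_mid)
    next
      case 4
      then show ?thesis using mu_l_less by (simp add: mu_mid)
    next
      case 5
      then show ?thesis using bl by (simp add: mu_out mu_l)
    qed
  qed
  have "{i. mu i \<noteq> 0} \<subseteq> {i. kap i \<noteq> 0}"
    using le by (metis (mono_tags, lifting) Collect_mono le_zero_eq)
  then have mu: "is_partition mu"
    using dec kap(1) unfolding is_partition_def
    by (auto simp: antimono_iff_le_Suc intro: finite_subset)
  define S where "S = young_diagram kap - young_diagram mu"
  have S: "(i, k) \<in> S \<longleftrightarrow> j \<le> i \<and> i \<le> l \<and> mu i \<le> k \<and> k < kap i" for i k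
    using mu_out[of i] by (cases "i < j \<or> l < i") (auto simp: S_def young_diagram_def)
  have "connected_cells S"
    by (rule connected_staircase[OF S]) (use less mu_mid in auto)
  moreover have "\<not> contains_2x2 S"
  proof
    assume "contains_2x2 S"
    then obtain i k where "(i, k) \<in> S" "(Suc i, Suc k) \<in> S" by (auto simp: contains_2x2_def)
    then show False using mu_mid[of i] by (auto simp: S)
  qed
  \<comment> \<open>Above row \<open>l\<close>, the cells removed from row i number
    \<open>\<beta> i - \<beta> (Suc i)\<close>. These telescope to b - \<open>\<beta> l\<close>, and
    row \<open>l\<close> contributes the remaining \<open>\<beta> l\<close> - (b - t).\<close>
  moreover have "card S = t"
  proof -
    have "S = Sigma {j..l} (\<lambda>i. {mu i..<kap i})" by (auto simp: S)
    then have "card S = (\<Sum>i\<in>{j..l}. kap i - mu i)" by (simp add: card_SigmaI)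
    also have "int \<dots> = (\<Sum>i\<in>{j..l}. int (kap i) - int (mu i))"
      using le by (simp add: of_nat_diff)
    also have "\<dots> = (\<Sum>i\<in>{j..<l}. int (kap i) - int (mu i)) + (int (kap l) - int (mu l))"
      using l(1) by (simp add: sum.last_plus)
    also have "(\<Sum>i\<in>{j..<l}. int (kap i) - int (mu i)) = (\<Sum>i\<in>{j..<l}. (- int (\<beta> (Suc i))) - (- int (\<beta> i)))"
    proof (intro sum.cong refl)
      fix i assume "i \<in> {j..<l}"
      then have "j \<le> i" "i < l" "Suc i < m" using l(2) by auto
      then show "int (kap i) - int (mu i) = - int (\<beta> (Suc i)) - - int (\<beta> i)"
        using kap_pos[of "Suc i"] by (simp add: mu_mid \<beta>_def of_nat_diff)
    qed
    also have "\<dots> = int (\<beta> j) - int (\<beta> l)" using l(1) by (subst sum_Suc_diff') auto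
    also have "\<dots> + (int (kap l) - int (mu l)) = int t"
      using bl b by (simp add: mu_l \<beta>_def of_nat_diff)
    finally show ?thesis by simp
  qed
  moreover have "young_diagram mu \<subseteq> young_diagram kap"
    using le by (force simp: young_diagram_def intro: less_le_trans)
  ultimately have "remove_border_strip t kap mu"
    using kap(1) mu by (simp add: remove_border_strip_def S_def[symmetric] Let_def)
  then show ?thesis by blast
qed

section \<open>Beta sets as strictly decreasing lists\<close>

lemma set_beta_set: "set (beta_set lam m) = (\<lambda>j. lam j + (m - 1 - j)) ` {..<m}"
  by (auto simp: beta_set_def)

lemma length_beta_set [simp]: "length (beta_set lam m) = m"
  by (simp add: beta_set_def)

lemma beta_set_nth: "j < m \<Longrightarrow> beta_set lam m ! j = lam j + (m - 1 - j)"
  by (simp add: beta_set_def)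

lemma beta_set_decreasing:
  assumes "is_partition lam"
  shows "sorted_wrt (>) (beta_set lam m)"
  using beta_strictly_decreasing[OF assms] by (auto simp: sorted_wrt_iff_nth_less beta_set_nth)

lemma decreasing_list_unique:
  fixes xs ys :: "'a :: linorder list"
  assumes "sorted_wrt (>) xs" "sorted_wrt (>) ys" "set xs = set ys"
  shows "xs = ys"
proof -
  have "sorted_wrt (<) (rev xs)" "sorted_wrt (<) (rev ys)"
    using assms by (simp_all add: sorted_wrt_rev)
  then have "rev xs = rev ys" by (intro strict_sorted_equal) (use assms(3) in auto)
  then show ?thesis by simp
qed

lemma decreasing_distinct: "sorted_wrt (>) (xs :: 'a :: linorder list) \<Longrightarrow> distinct xs"
  by (induction xs) auto

lemma beta_residue_decreasing: "is_partition lam \<Longrightarrow> sorted_wrt (>) (beta_residue t lam m r)"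
  unfolding beta_residue_def by (intro sorted_wrt_filter beta_set_decreasing)

lemma residue_count_eq_card:
  assumes "is_partition lam"
  shows "residue_count t lam m r = card {b \<in> set (beta_set lam m). b mod t = r}"
  using distinct_card[OF decreasing_distinct[OF beta_residue_decreasing[OF assms]], of t m r]
  by (simp add: residue_count_def) (simp add: beta_residue_def)

lemma partition_eqI_beta_set:
  assumes "is_partition lam" "is_partition mu" "\<forall>i\<ge>m. lam i = 0" "\<forall>i\<ge>m. mu i = 0"
    and "set (beta_set lam m) = set (beta_set mu m)"
  shows "lam = mu"
proof
  fix i
  have "beta_set lam m = beta_set mu m"
    using assms by (intro decreasing_list_unique beta_set_decreasing)
  then show "lam i = mu i"
    using assms(3,4) by (cases "i < m") (metis beta_set_nth add_right_cancel, simp)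
qed

section \<open>Residue counts determine the core\<close>

lemma down_closed_nat_set:
  assumes "finite (A :: nat set)" "\<And>q. Suc q \<in> A \<Longrightarrow> q \<in> A"
  shows "A = {..<card A}"
proof -
  have down: "q - d \<in> A" if "q \<in> A" for q d
  proof (induction d)
    case (Suc d)
    then show ?case using assms(2)[of "q - Suc d"] by (cases "q - d") (auto simp: diff_Suc)
  qed (use that in simp)
  have le: "q' \<in> A" if "q \<in> A" "q' \<le> q" for q q'
    using down[OF that(1), of "q - q'"] that(2) by simp
  show ?thesis
  proof (cases "A = {}")
    case False
    then have "Max A \<in> A" using assms(1) by simp
    then have "A = {..Max A}"
      using assms(1) le by (auto intro: Max_ge)
    then have "A = {..<Suc (Max A)}" by (simp only: lessThan_Suc_atMost)
    then show ?thesis by (metis card_lessThan)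
  qed simp
qed

lemma mod_class_eq_image:
  fixes t :: nat
  assumes "r < t"
  shows "{b \<in> B. b mod t = r} = (\<lambda>q. t * q + r) ` {q. t * q + r \<in> B}"
proof -
  have "b = t * (b div t) + r" if "b mod t = r" for b
    using that by (metis mult_div_mod_eq)
  then show ?thesis using assms by (force simp: image_iff)
qed

lemma card_mod_class:
  fixes t :: nat
  assumes "r < t"
  shows "card {b \<in> B. b mod t = r} = card {q. t * q + r \<in> B}"
  unfolding mod_class_eq_image[OF assms] using assms by (intro card_image) (auto simp: inj_on_def)

text \<open>Within one residue class, closure under subtracting t makes the set of quotients an
  initial segment of the naturals. Its cardinality then decides membership.\<close>

lemma closed_set_characterization:
  fixes t :: nat
  assumes "finite B" "t > 0" "\<And>b. b \<in> B \<Longrightarrow> t \<le> b \<Longrightarrow> b - t \<in> B"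
  shows "b \<in> B \<longleftrightarrow> b div t < card {b' \<in> B. b' mod t = b mod t}"
proof -
  define A where "A = {q. t * q + b mod t \<in> B}"
  have "finite ((\<lambda>q. t * q + b mod t) ` A)"
    by (rule finite_subset[OF _ assms(1)]) (auto simp: A_def)
  then have "finite A" by (rule finite_imageD) (use assms(2) in \<open>auto simp: inj_on_def\<close>)
  moreover have "q \<in> A" if "Suc q \<in> A" for q
    using assms(3)[of "t * Suc q + b mod t"] that by (simp add: A_def add.assoc)
  ultimately have "A = {..<card A}" by (rule down_closed_nat_set)
  moreover have "b \<in> B \<longleftrightarrow> b div t \<in> A" by (simp add: A_def)
  ultimately have "b \<in> B \<longleftrightarrow> b div t < card A" by (metis lessThan_iff)
  then show ?thesis using card_mod_class[of "b mod t" t B] assms(2) by (simp add: A_def)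
qed

text \<open>If no strip can be removed, no beta number b \<ge> t has b - t free, so the beta set is
  closed under subtracting t.\<close>

lemma core_beta_set:
  assumes "is_partition kap" "\<forall>i\<ge>m. kap i = 0" "t > 0" "\<nexists>mu. remove_border_strip t kap mu"
  shows "b \<in> set (beta_set kap m) \<longleftrightarrow> b div t < residue_count t kap m (b mod t)"
  unfolding residue_count_eq_card[OF assms(1)]
proof (rule closed_set_characterization)
  fix b assume b: "b \<in> set (beta_set kap m)" "t \<le> b"
  then obtain j where j: "j < m" "b = kap j + (m - 1 - j)" by (auto simp: set_beta_set)
  show "b - t \<in> set (beta_set kap m)"
  proof (rule ccontr)
    assume "b - t \<notin> set (beta_set kap m)"
    then have "\<forall>i<m. kap i + (m - 1 - i) \<noteq> b - t"
      unfolding set_beta_set image_iff by (metis lessThan_iff)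
    with remove_border_strip_exists[OF assms(1,2,3) j b(2)] assms(4) show False by blast
  qed
qed (use assms in auto)

lemma reachable_properties:
  assumes "(remove_border_strip t)\<^sup>*\<^sup>* lam kap" "is_partition lam" "\<forall>i\<ge>m. lam i = 0" "t > 0"
  shows "is_partition kap \<and> (\<forall>i\<ge>m. kap i = 0) \<and> (\<forall>r. residue_count t kap m r = residue_count t lam m r)"
  using assms(1)
proof induction
  case (step mu nu)
  have "is_partition nu" using step(2) by (simp add: remove_border_strip_def)
  moreover have "\<forall>i\<ge>m. nu i = 0"
    using step(3) remove_border_strip_le[OF step(2)] by (metis le_zero_eq)
  ultimately show ?case using step(3) remove_border_strip_residue_count[OF step(2) assms(4)] by simp
qed (use assms in simp)

text \<open>Each removal shrinks a finite diagram, so the process stops.\<close>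

lemma terminal_exists:
  assumes "t > 0" "is_partition lam"
  shows "\<exists>kap. (remove_border_strip t)\<^sup>*\<^sup>* lam kap \<and> (\<nexists>mu. remove_border_strip t kap mu)"
  using assms(2)
proof (induction "card (young_diagram lam)" arbitrary: lam rule: less_induct)
  case less
  show ?case
  proof (cases "\<exists>mu. remove_border_strip t lam mu")
    case True
    then obtain mu where mu: "remove_border_strip t lam mu" ..
    have "\<forall>i\<ge>part_length lam. lam i = 0" using partition_eq_0[OF less.prems] by blast
    then have "finite (young_diagram lam)" by (simp add: young_diagram_Sigma)
    moreover have "young_diagram mu \<subset> young_diagram lam"
      using mu assms(1) by (auto simp: remove_border_strip_def Let_def)
    ultimately have "card (young_diagram mu) < card (young_diagram lam)" by (rule psubset_card_mono)
    moreover have "is_partition mu" using mu by (simp add: remove_border_strip_def)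
    ultimately show ?thesis using less.hyps mu by (meson converse_rtranclp_into_rtranclp)
  qed blast
qed

text \<open>Removals preserve the residue counts, and these determine the beta set of a terminal
  shape. All terminal shapes reachable from \<open>lam\<close> therefore coincide, which makes the
  description in \<open>t_core\<close> well defined.\<close>

lemma t_core_properties:
  assumes "t > 0" "is_partition lam" "\<forall>i\<ge>m. lam i = 0"
  shows "is_partition (t_core t lam)" "\<forall>i\<ge>m. t_core t lam i = 0"
    "residue_count t (t_core t lam) m r = residue_count t lam m r"
    "b \<in> set (beta_set (t_core t lam) m) \<longleftrightarrow> b div t < residue_count t lam m (b mod t)"
proof -
  let ?P = "\<lambda>kap. (remove_border_strip t)\<^sup>*\<^sup>* lam kap \<and> (\<nexists>mu. remove_border_strip t kap mu)"
  have props: "is_partition kap" "\<forall>i\<ge>m. kap i = 0" "\<forall>r. residue_count t kap m r = residue_count t lam m r"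
    "b \<in> set (beta_set kap m) \<longleftrightarrow> b div t < residue_count t lam m (b mod t)" if "?P kap" for kap b
  proof -
    show *: "is_partition kap" "\<forall>i\<ge>m. kap i = 0" "\<forall>r. residue_count t kap m r = residue_count t lam m r"
      using reachable_properties[OF conjunct1[OF that] assms(2,3,1)] by blast+
    show "b \<in> set (beta_set kap m) \<longleftrightarrow> b div t < residue_count t lam m (b mod t)"
      using core_beta_set[OF *(1,2) assms(1) conjunct2[OF that], of b] *(3) by metis
  qed
  have "\<exists>!kap. ?P kap"
  proof (rule ex_ex1I)
    show "\<exists>kap. ?P kap" by (rule terminal_exists[OF assms(1,2)])
    fix kap kap'
    assume "?P kap" "?P kap'"
    note p = props[OF \<open>?P kap\<close>] and p' = props[OF \<open>?P kap'\<close>]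
    have "set (beta_set kap m) = set (beta_set kap' m)" by (rule Set.set_eqI) (simp only: p(4) p'(4))
    with p(1,2) p'(1,2) show "kap = kap'" by (intro partition_eqI_beta_set[of _ _ m])
  qed
  then have "?P (t_core t lam)" unfolding t_core_def by (rule theI')
  from props[OF this] show "is_partition (t_core t lam)" "\<forall>i\<ge>m. t_core t lam i = 0"
    "residue_count t (t_core t lam) m r = residue_count t lam m r"
    "b \<in> set (beta_set (t_core t lam) m) \<longleftrightarrow> b div t < residue_count t lam m (b mod t)"
    by blast+
qed

section \<open>One-row cores\<close>

lemma is_partition_one_row: "is_partition (one_row c)"
  by (auto simp: is_partition_def one_row_def antimono_def)

lemma set_beta_set_one_row: "set (beta_set (one_row c) (k + 1)) = insert (k + c) {..<k}"
proof -
  have "{..<k + 1} = insert 0 {1..<k + 1}" by auto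
  moreover have "(\<lambda>j. k - j) ` {1..<k + 1} = {..<k}"
  proof
    show "{..<k} \<subseteq> (\<lambda>j. k - j) ` {1..<k + 1}"
      by (rule subsetI, rule_tac x = "k - x" in image_eqI) auto
  qed auto
  moreover have "(\<lambda>j. one_row c j + (k - j)) ` {1..<k + 1} = (\<lambda>j. k - j) ` {1..<k + 1}"
    by (intro image_cong) (auto simp: one_row_def)
  ultimately show ?thesis unfolding set_beta_set by (simp add: one_row_def add.commute)
qed

text \<open>The numbers below t * n fill the first n places of every class, and t * n + c adds one
  more place in class c. The form matches the membership criterion for cores, so that the two can be
  compared directly.\<close>

lemma mem_beta_set_one_row:
  assumes "c < t"
  shows "b \<in> set (beta_set (one_row c) (t * n + 1)) \<longleftrightarrow>
    b div t < (if b mod t = c then Suc n else n)"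
proof -
  have lt: "b div t < n \<longleftrightarrow> b < t * n"
    using assms by (simp add: div_less_iff_less_mult mult.commute)
  have eq: "b div t = n \<and> b mod t = c \<longleftrightarrow> b = t * n + c"
    using assms by (auto simp: mult_div_mod_eq) 
  show ?thesis
    using lt eq unfolding set_beta_set_one_row by (auto simp: less_Suc_eq)
qed

lemma residue_count_one_row:
  assumes "c < t" "r < t"
  shows "residue_count t (one_row c) (t * n + 1) r = (if r = c then Suc n else n)"
proof -
  have "{q. t * q + r \<in> set (beta_set (one_row c) (t * n + 1))} = {..<(if r = c then Suc n else n)}"
    using assms unfolding mem_beta_set_one_row[OF assms(1)] by auto
  then show ?thesis
    unfolding residue_count_eq_card[OF is_partition_one_row] card_mod_class[OF assms(2)] by simp
qed

lemma t_core_eq_one_row_iff: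
  assumes "c < t" "is_partition lam" "\<forall>i\<ge>t * n + 1. lam i = 0"
  shows "t_core t lam = one_row c \<longleftrightarrow>
    (\<forall>r<t. residue_count t lam (t * n + 1) r = (if r = c then Suc n else n))"
proof
  have "t > 0" using assms(1) by simp
  note core = t_core_properties[OF this assms(2,3)]
  show "t_core t lam = one_row c"
    if "\<forall>r<t. residue_count t lam (t * n + 1) r = (if r = c then Suc n else n)"
  proof (rule partition_eqI_beta_set[OF core(1) is_partition_one_row core(2)])
    show "\<forall>i\<ge>t * n + 1. one_row c i = 0" by (simp add: one_row_def)
    show "set (beta_set (t_core t lam) (t * n + 1)) = set (beta_set (one_row c) (t * n + 1))"
      using that \<open>t > 0\<close> by (intro Set.set_eqI) (simp add: core(4) mem_beta_set_one_row[OF assms(1)] del: One_nat_def)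
  qed
  show "\<forall>r<t. residue_count t lam (t * n + 1) r = (if r = c then Suc n else n)"
    if "t_core t lam = one_row c"
    using core(3) residue_count_one_row[OF assms(1)] that by metis
qed

lemma part_length_one_row_le: "part_length (one_row c) \<le> 1"
proof -
  have "{i. one_row c i \<noteq> 0} \<subseteq> {0}" by (auto simp: one_row_def)
  then have "card {i. one_row c i \<noteq> 0} \<le> card {0 :: nat}" by (intro card_mono) auto
  then show ?thesis by (simp add: part_length_def)
qed

section \<open>Signs of sorting permutations\<close>

definition index_pairs :: "nat \<Rightarrow> (nat \<times> nat) set" where
  "index_pairs m = {(i, j). i < j \<and> j < m}"

text \<open>The sign as a product over pairs, so that multiplicativity can be checked factor by
  factor.\<close>

definition inversion_sign :: "nat \<Rightarrow> (nat \<Rightarrow> nat) \<Rightarrow> int" where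
  "inversion_sign m p = (\<Prod>(i, j)\<in>index_pairs m. if p j < p i then -1 else 1)"

lemma finite_index_pairs [simp]: "finite (index_pairs m)"
  by (rule finite_subset[of _ "{..<m} \<times> {..<m}"]) (auto simp: index_pairs_def)

lemma inversion_sign_eq_power:
  "inversion_sign m p = (-1) ^ card {(i, j). i < j \<and> j < m \<and> p j < p i}"
proof -
  have "inversion_sign m p = (\<Prod>x\<in>{x \<in> index_pairs m. p (snd x) < p (fst x)}. -1)"
    unfolding inversion_sign_def
    by (subst prod.inter_filter) (auto intro!: prod.cong)
  also have "{x \<in> index_pairs m. p (snd x) < p (fst x)} = {(i, j). i < j \<and> j < m \<and> p j < p i}"
    by (auto simp: index_pairs_def)
  finally show ?thesis by simp
qed

lemma inversion_sign_compose:
  assumes p: "p permutes {0..<m}" and q: "q permutes {0..<m}"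
  shows "inversion_sign m (q \<circ> p) = inversion_sign m q * inversion_sign m p"
proof -
  let ?T = "index_pairs m"
  \<comment> \<open>For inverted pairs, \<open>q\<close> reverses the order of \<open>p i\<close> and \<open>p j\<close> or \<open>p\<close> reverses that of \<open>i\<close> and \<open>j\<close>,
    but not both; whether \<open>q\<close> reverses it depends only on the unordered pair.\<close>
  define h :: "nat \<times> nat \<Rightarrow> int" where "h = (\<lambda>(u, v). if (q v < q u) \<noteq> (v < u) then -1 else 1)"
  define \<phi> where "\<phi> = (\<lambda>(i, j). (min (p i) (p j), max (p i) (p j)))"
  have pinj: "p i = p j \<longleftrightarrow> i = j" for i j using permutes_inj[OF p] by (auto simp: inj_def)
  have qinj: "q i = q j \<longleftrightarrow> i = j" for i j using permutes_inj[OF q] by (auto simp: inj_def)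
  have plt: "p i < m" if "i < m" for i using permutes_in_image[OF p, of i] that by simp
  have "\<phi> ` ?T \<subseteq> ?T"
  proof clarify
    fix i j u v assume "(i, j) \<in> ?T" "(u, v) = \<phi> (i, j)"
    moreover from this have "p i \<noteq> p j" "p i < m" "p j < m"
      using plt by (auto simp: index_pairs_def pinj)
    ultimately show "(u, v) \<in> ?T" by (auto simp: \<phi>_def index_pairs_def)
  qed
  moreover have inj: "inj_on \<phi> ?T"
  proof (rule inj_onI, clarify)
    fix i j i' j'
    assume *: "(i, j) \<in> ?T" "(i', j') \<in> ?T" "\<phi> (i, j) = \<phi> (i', j')"
    then have "(p i = p i' \<and> p j = p j') \<or> (p i = p j' \<and> p j = p i')"
      unfolding \<phi>_def by (simp add: min_def max_def split: if_splits)
    with * show "i = i' \<and> j = j'" unfolding pinj by (auto simp: index_pairs_def)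
  qed
  ultimately have bij: "\<phi> ` ?T = ?T" by (intro endo_inj_surj) auto
  have "inversion_sign m (q \<circ> p) = (\<Prod>(i, j)\<in>?T. h (\<phi> (i, j)) * (if p j < p i then -1 else 1))"
    unfolding inversion_sign_def
  proof (intro prod.cong refl, clarify)
    fix i j assume "(i, j) \<in> ?T"
    then have "p i \<noteq> p j" "q (p i) \<noteq> q (p j)" by (auto simp: index_pairs_def pinj qinj)
    then show "(if (q \<circ> p) j < (q \<circ> p) i then - 1 else 1) = h (\<phi> (i, j)) * (if p j < p i then - 1 else 1)"
      by (cases "p i < p j"; cases "q (p i) < q (p j)") (auto simp: h_def \<phi>_def)
  qed
  also have "\<dots> = (\<Prod>x\<in>?T. h (\<phi> x)) * inversion_sign m p"
    unfolding inversion_sign_def by (subst prod.distrib[symmetric]) (auto intro!: prod.cong)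
  also have "(\<Prod>x\<in>?T. h (\<phi> x)) = prod h (\<phi> ` ?T)" using inj by (simp add: prod.reindex)
  also have "\<dots> = inversion_sign m q"
    unfolding bij inversion_sign_def by (intro prod.cong) (auto simp: h_def index_pairs_def)
  finally show ?thesis .
qed

text \<open>Besides (a, b) itself, each value strictly between a and b gives two inversions, one
  with each end. The total is odd.\<close>

lemma inversion_sign_transpose:
  assumes "a < b" "b < m"
  shows "inversion_sign m (Transposition.transpose a b) = -1"
proof -
  have "{(i, j). i < j \<and> j < m \<and> Transposition.transpose a b j < Transposition.transpose a b i} =
    insert (a, b) ({a} \<times> {a<..<b} \<union> {a<..<b} \<times> {b})" (is "?I = _")
    using assms by (auto simp: Transposition.transpose_def split: if_splits)
  also have "card \<dots> = 1 + ((b - Suc a) + (b - Suc a))"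
    by (subst card_insert_disjoint, simp, simp, subst card_Un_disjoint) (auto simp: card_cartesian_product)
  finally show ?thesis unfolding inversion_sign_eq_power by (simp flip: mult_2)
qed

text \<open>Both sides are multiplicative and equal -1 on transpositions, which generate all
  permutations.\<close>

lemma sign_eq_inversion_sign:
  assumes "p permutes {0..<m}"
  shows "sign p = inversion_sign m p"
  using assms finite_atLeastLessThan
proof (induction rule: permutes_induct)
  case id
  have "{(i, j). i < j \<and> j < m \<and> id j < id i} = {}" by auto
  then show ?case unfolding inversion_sign_eq_power by (simp only: sign_id card.empty power_0)
next
  case (swap a b p)
  let ?s = "Transposition.transpose a b"
  have s: "?s permutes {0..<m}" using swap by (intro permutes_swap_id) auto
  have "inversion_sign m ?s = -1"
    using swap inversion_sign_transpose[of a b m] inversion_sign_transpose[of b a m]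
    by (cases "a < b") (auto simp: transpose_commute)
  moreover have "permutation ?s" "permutation p"
    using s swap by (auto intro: permutes_imp_permutation[of "{0..<m}"])
  ultimately show ?case
    using swap by (simp only: sign_compose sign_swap_id inversion_sign_compose[OF \<open>p permutes {0..<m}\<close> s] if_False)
qed

section \<open>Sorting the beta numbers by residue\<close>

lemma mset_concat_residues:
  fixes t :: nat
  assumes "distinct rs" "set rs = {..<t}" "t > 0"
  shows "mset (concat (map (\<lambda>i. filter (\<lambda>b. b mod t = i) bs) rs)) = mset bs"
proof (rule multiset_eqI)
  fix a
  have "count (mset (concat (map (\<lambda>i. filter (\<lambda>b. b mod t = i) bs) rs))) a =
    (\<Sum>i\<leftarrow>rs. if a mod t = i then count (mset bs) a else 0)"
    by (induction rs) auto
  also have "\<dots> = (\<Sum>i<t. if a mod t = i then count (mset bs) a else 0)"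
    using assms by (simp add: sum_list_distinct_conv_sum_set)
  also have "\<dots> = count (mset bs) a" using assms(3) by simp
  finally show "count (mset (concat (map (\<lambda>i. filter (\<lambda>b. b mod t = i) bs) rs))) a = count (mset bs) a" .
qed

text \<open>A sorting permutation exists because both lists have the same multiset of entries. It is
  unique because the beta numbers are distinct and the permutation is the identity outside
  {0..<m}.\<close>

lemma sort_perm_sorts:
  assumes "is_partition lam" "c < t"
  shows "sort_perm t lam m c permutes {0..<m}"
    "map (\<lambda>k. beta_set lam m ! sort_perm t lam m c k) [0..<m] =
      concat (map (beta_residue t lam m) (c # filter (\<lambda>i. i \<noteq> c) [0..<t]))"
proof -
  let ?L = "concat (map (beta_residue t lam m) (c # filter (\<lambda>i. i \<noteq> c) [0..<t]))"
  let ?P = "\<lambda>p. p permutes {0..<m} \<and> map (\<lambda>k. beta_set lam m ! p k) [0..<m] = ?L"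
  have "mset ?L = mset (beta_set lam m)"
    unfolding beta_residue_def using assms(2) by (intro mset_concat_residues) auto
  then obtain p where "p permutes {..<m}" "permute_list p (beta_set lam m) = ?L"
    by (metis mset_eq_permutation length_beta_set)
  then have "?P p" by (simp add: permute_list_def atLeast0LessThan)
  moreover have "p = q" if "?P p" "?P q" for p q
  proof
    fix k
    show "p k = q k"
    proof (cases "k < m")
      case True
      then have "beta_set lam m ! p k = beta_set lam m ! q k"
        using that by (metis (no_types, lifting) add_0 length_map length_upt minus_nat.diff_0 nth_map nth_upt)
      moreover have "p k < m" "q k < m"
        using that True permutes_in_image[of p "{0..<m}" k] permutes_in_image[of q "{0..<m}" k] by auto
      ultimately show ?thesis
        using decreasing_distinct[OF beta_set_decreasing[OF assms(1)]]
        by (metis length_beta_set nth_eq_iff_index_eq)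
    next
      case False
      then show ?thesis using that permutes_not_in[of _ "{0..<m}" k] by (metis atLeastLessThan_iff)
    qed
  qed
  ultimately have "\<exists>!p. ?P p" by blast
  then have "?P (sort_perm t lam m c)" unfolding sort_perm_def by (rule theI')
  then show "sort_perm t lam m c permutes {0..<m}"
    "map (\<lambda>k. beta_set lam m ! sort_perm t lam m c k) [0..<m] = ?L" by blast+
qed

text \<open>The beta list decreases, so a pair of positions is inverted exactly where
  \<open>L\<close> ascends. The sign can thus be read off \<open>L\<close> alone.\<close>

lemma sign_sort_perm:
  assumes "is_partition lam" "c < t"
    and L: "L = concat (map (beta_residue t lam m) (c # filter (\<lambda>i. i \<noteq> c) [0..<t]))"
  shows "sign (sort_perm t lam m c) = (-1) ^ card {(i, j). i < j \<and> j < m \<and> L ! i < L ! j}"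
proof -
  define p where "p = sort_perm t lam m c"
  note p = sort_perm_sorts[OF assms(1,2), of m, folded L p_def]
  have nth: "L ! i = beta_set lam m ! p i" if "i < m" for i
    using that unfolding p(2)[symmetric] by simp
  have plt: "p i < m" if "i < m" for i using permutes_in_image[OF p(1), of i] that by simp
  have dec: "beta_set lam m ! j < beta_set lam m ! i" if "i < j" "j < m" for i j
    using beta_set_decreasing[OF assms(1), of m] that by (simp add: sorted_wrt_iff_nth_less)
  have "p j < p i \<longleftrightarrow> L ! i < L ! j" if "i < j" "j < m" for i j
    using that dec[of "p j" "p i"] dec[of "p i" "p j"] plt[of i] plt[of j]
    by (cases "p i" "p j" rule: linorder_cases) (auto simp: nth)
  then have "{(i, j). i < j \<and> j < m \<and> p j < p i} = {(i, j). i < j \<and> j < m \<and> L ! i < L ! j}"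
    by auto
  then show ?thesis
    unfolding p_def[symmetric] sign_eq_inversion_sign[OF p(1)] inversion_sign_eq_power by simp
qed

section \<open>The sorting sign of the empty partition\<close>

lemma sorted_wrt_concat_residues:
  assumes "is_partition lam" "sorted_wrt (<) rs"
  shows "sorted_wrt (\<lambda>u v. u mod t < v mod t \<or> u mod t = v mod t \<and> u > v)
    (concat (map (beta_residue t lam m) rs))"
  using assms(2)
proof (induction rs)
  case (Cons r rs)
  have "sorted_wrt (\<lambda>u v. u mod t < v mod t \<or> u mod t = v mod t \<and> u > v) (beta_residue t lam m r)"
    by (rule sorted_wrt_mono_rel[OF _ beta_residue_decreasing[OF assms(1)]])
      (auto simp: beta_residue_def)
  then show ?case using Cons by (auto simp: sorted_wrt_append beta_residue_def)
qed simp

lemma card_pairs_less: "card {(a, b). a < b \<and> b < (t :: nat)} = t * (t - 1) div 2"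
proof -
  have "{(a, b). a < b \<and> b < t} = prod.swap ` Sigma {..<t} (\<lambda>b. {..<b})" by (auto simp: image_iff)
  then have "card {(a, b). a < b \<and> b < t} = (\<Sum>b<t. b)"
    by (simp add: card_image card_SigmaI)
  also have "\<dots> = t * (t - 1) div 2" using Sum_Ico_nat[of 0 t] by (simp add: atLeast0LessThan)
  finally show ?thesis .
qed

lemma card_pairs_le: "card {(a, b). a \<le> b \<and> b < (n :: nat)} = n * (n + 1) div 2"
proof -
  have "{(a, b). a \<le> b \<and> b < n} = prod.swap ` Sigma {..<n} (\<lambda>b. {..b})" by (auto simp: image_iff)
  then have "card {(a, b). a \<le> b \<and> b < n} = (\<Sum>b<n. Suc b)"
    by (simp add: card_image card_SigmaI)
  also have "\<dots> = (\<Sum>b<Suc n. b)" by (subst sum.lessThan_Suc_shift) simp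
  also have "\<dots> = n * (n + 1) div 2"
    using Sum_Ico_nat[of 0 "Suc n"] by (simp add: atLeast0LessThan mult.commute)
  finally show ?thesis .
qed

text \<open>Write u = t * a + r and v = t * b + r'. For r < r' the condition u < v becomes a \<le>
  b. The largest value t * n has residue 0 and cannot be v, hence b < n, and the pairs of residues
  and of quotients are chosen independently.\<close>

lemma card_residue_inversions:
  fixes t n :: nat
  assumes "t > 0"
  shows "card {(u, v). u < v \<and> v < t * n + 1 \<and> u mod t < v mod t} = (t * (t - 1) div 2) * (n * (n + 1) div 2)"
proof -
  let ?J = "{(u, v). u < v \<and> v < t * n + 1 \<and> u mod t < v mod t}"
  let ?f = "\<lambda>((r, r'), (a, b)). (t * a + r, t * b + r')"
  let ?D = "{(r, r'). r < r' \<and> r' < t} \<times> {(a, b). a \<le> b \<and> b < n}"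
  have "bij_betw ?f ?D ?J"
  proof (rule bij_betw_byWitness[where f' = "\<lambda>(u, v). ((u mod t, v mod t), (u div t, v div t))"])
    show "?f ` ?D \<subseteq> ?J"
    proof clarsimp
      fix a b r r' assume *: "a \<le> b" "b < n" "r < r'" "r' < t"
      have "t * a \<le> t * b" using *(1) by (rule mult_le_mono2)
      moreover have "t * Suc b \<le> t * n" using *(2) by (intro mult_le_mono2) simp
      then have "t * b + t \<le> t * n" by simp
      ultimately show "t * a + r < t * b + r' \<and> t * b + r' < Suc (t * n)" using *(3,4) by linarith
    qed
    show "(\<lambda>(u, v). ((u mod t, v mod t), (u div t, v div t))) ` ?J \<subseteq> ?D"
    proof clarsimp
      fix u v assume *: "u < v" "v < Suc (t * n)" "u mod t < v mod t"
      then have "v \<noteq> t * n" by auto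
      with * have "v < t * n" by simp
      then have "v div t < n" using assms by (simp add: div_less_iff_less_mult mult.commute)
      with * assms show "v mod t < t \<and> u div t \<le> v div t \<and> v div t < n" by (simp add: div_le_mono)
    qed
  qed (use assms in auto)
  then have "card ?J = card ?D" by (simp add: bij_betw_same_card)
  also have "\<dots> = (t * (t - 1) div 2) * (n * (n + 1) div 2)"
    by (simp only: card_cartesian_product card_pairs_less card_pairs_le)
  finally show ?thesis .
qed

text \<open>This sign comes from the Vandermonde denominator and supplies the part of the exponent
  that does not depend on c. The ascending pairs of positions in \<open>L\<close> correspond to the
  pairs of values counted in \<open>card_residue_inversions\<close>.\<close>

lemma sign_sort_perm_empty:
  assumes "t > 0"
  shows "sign (sort_perm t (one_row 0) (t * n + 1) 0) = (-1) ^ ((t * (t - 1) div 2) * (n * (n + 1) div 2))"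
proof -
  define m where "m = t * n + 1"
  define L where "L = concat (map (beta_residue t (one_row 0) m) (0 # filter (\<lambda>i. i \<noteq> 0) [0..<t]))"
  \<comment> \<open>For c = 0 the class moved to the front is already first, so the residues appear
    in increasing order.\<close>
  have "0 # filter (\<lambda>i. i \<noteq> 0) [0..<t] = [0..<t]"
    using assms by (simp add: upt_conv_Cons filter_id_conv)
  then have sorted: "sorted_wrt (\<lambda>u v. u mod t < v mod t \<or> u mod t = v mod t \<and> u > v) L"
    unfolding L_def by (simp only: sorted_wrt_concat_residues[OF is_partition_one_row] sorted_wrt_upt)
  have mset: "mset L = mset (beta_set (one_row 0) m)"
    unfolding beta_residue_def L_def using assms by (intro mset_concat_residues) auto
  have len: "length L = m" using mset_eq_length[OF mset] by simp
  have "set L = {..<m}"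
    unfolding mset_eq_setD[OF mset] m_def set_beta_set_one_row by auto
  have dist: "distinct L"
    unfolding mset_eq_imp_distinct_iff[OF mset]
    by (rule decreasing_distinct[OF beta_set_decreasing[OF is_partition_one_row]])
  have ord: "L ! i mod t < L ! j mod t \<or> L ! i mod t = L ! j mod t \<and> L ! i > L ! j"
    if "i < j" "j < m" for i j
    by (rule sorted_wrt_nth_less[OF sorted]) (use that len in auto)
  let ?I = "{(i, j). i < j \<and> j < m \<and> L ! i < L ! j}"
  let ?J = "{(u, v). u < v \<and> v < m \<and> u mod t < v mod t}"
  have img: "(\<lambda>(i, j). (L ! i, L ! j)) ` ?I = ?J"
  proof (intro equalityI subsetI)
    fix x assume "x \<in> (\<lambda>(i, j). (L ! i, L ! j)) ` ?I"
    then obtain i j where *: "x = (L ! i, L ! j)" "i < j" "j < m" "L ! i < L ! j" by auto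
    have "L ! j < m" using \<open>set L = {..<m}\<close> len * by (metis lessThan_iff nth_mem)
    with * ord[of i j] show "x \<in> ?J" by auto
  next
    fix x assume "x \<in> ?J"
    then obtain u v where x: "x = (u, v)" and *: "u < v" "v < m" "u mod t < v mod t" by auto
    then obtain i j where ij: "i < m" "L ! i = u" "j < m" "L ! j = v"
      using \<open>set L = {..<m}\<close> len in_set_conv_nth[of u L] in_set_conv_nth[of v L] by auto
    then have "i < j" using ord[of j i] * by (cases i j rule: linorder_cases) auto
    with ij * show "x \<in> (\<lambda>(i, j). (L ! i, L ! j)) ` ?I"
      unfolding x by (intro image_eqI[of _ _ "(i, j)"]) auto
  qed
  have inj: "inj_on (\<lambda>(i, j). (L ! i, L ! j)) ?I"
  proof (rule inj_onI)
    fix x y assume *: "x \<in> ?I" "y \<in> ?I"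
      "(case x of (i, j) \<Rightarrow> (L ! i, L ! j)) = (case y of (i, j) \<Rightarrow> (L ! i, L ! j))"
    obtain i j i' j' where "x = (i, j)" "y = (i', j')" by (metis surj_pair)
    with * nth_eq_iff_index_eq[OF dist, of i i'] nth_eq_iff_index_eq[OF dist, of j j'] len
    show "x = y" by simp
  qed
  have "card ?I = card ?J" using card_image[OF inj] unfolding img by (rule sym)
  then show ?thesis
    using sign_sort_perm[OF is_partition_one_row assms L_def] card_residue_inversions[OF assms, of n]
    by (simp only: m_def)
qed

section \<open>The factorization of the numerator\<close>

lemma det_permute_cols:
  assumes A: "A \<in> carrier_mat n n" and p: "p permutes {0..<n}"
  shows "det (mat n n (\<lambda>(i, j). A $$ (i, p j))) = of_int (sign p) * det A"
proof -
  have plt: "p j < n" if "j < n" for j using permutes_in_image[OF p, of j] that by simp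
  have "det (mat n n (\<lambda>(i, j). A $$ (i, p j))) = det (mat n n (\<lambda>(i, j). A\<^sup>T $$ (p i, j)))"
    by (subst det_transpose[symmetric, of _ n]) (auto intro!: arg_cong[of _ _ det] eq_matI simp: plt A carrier_matD[OF A])
  also have "\<dots> = of_int (sign p) * det (A\<^sup>T)" using A p by (intro det_permute_rows) auto
  finally show ?thesis by (simp add: det_transpose[OF A])
qed

lemma det_block_diagonal:
  fixes F :: "nat \<Rightarrow> nat \<Rightarrow> nat \<Rightarrow> 'a :: idom"
  assumes "n > 0"
  shows "det (mat (s * n) (s * n) (\<lambda>(i, j). if i div n = j div n then F (i div n) (i mod n) (j mod n) else 0)) =
    (\<Prod>q<s. det (mat n n (\<lambda>(i, j). F q i j)))"
proof (induction s)
  case (Suc s)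
  let ?M = "\<lambda>s. mat (s * n) (s * n) (\<lambda>(i, j). if i div n = j div n then F (i div n) (i mod n) (j mod n) else 0)"
  have lt: "k div n < s" if "k < s * n" for k
    using that assms by (simp add: div_less_iff_less_mult)
  have ge: "k div n = s \<and> k mod n = k - s * n" if "\<not> k < s * n" "k < n + s * n" for k
  proof -
    have "k = s * n + (k - s * n)" "k - s * n < n" using that by auto
    then show ?thesis by (metis div_mult_self3 div_less add_0_right mod_mult_self3 mod_less assms neq0_conv)
  qed
  have blocks: "?M (Suc s) = four_block_mat (?M s) (0\<^sub>m (s * n) n) (0\<^sub>m n (s * n)) (mat n n (\<lambda>(i, j). F s i j))"
  proof (rule eq_matI)
    fix i j assume "i < dim_row (four_block_mat (?M s) (0\<^sub>m (s * n) n) (0\<^sub>m n (s * n)) (mat n n (\<lambda>(i, j). F s i j)))"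
      "j < dim_col (four_block_mat (?M s) (0\<^sub>m (s * n) n) (0\<^sub>m n (s * n)) (mat n n (\<lambda>(i, j). F s i j)))"
    then have *: "i < n + s * n" "j < n + s * n" by auto
    show "?M (Suc s) $$ (i, j) =
      four_block_mat (?M s) (0\<^sub>m (s * n) n) (0\<^sub>m n (s * n)) (mat n n (\<lambda>(i, j). F s i j)) $$ (i, j)"
      using * lt[of i] lt[of j] ge[of i] ge[of j]
      by (cases "i < s * n"; cases "j < s * n") (auto simp: add.commute)
  qed auto
  have "det (?M (Suc s)) = det (?M s) * det (mat n n (\<lambda>(i, j). F s i j))"
    unfolding blocks by (rule det_four_block_mat_lower_left_zero) auto
  then show ?case using Suc by simp
qed simp

lemma nth_concat_equal_lengths:
  assumes "\<And>r. r \<in> set rs \<Longrightarrow> length (f r) = n" "q < length rs * n"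
  shows "concat (map f rs) ! q = f (rs ! (q div n)) ! (q mod n)"
  using assms
proof (induction rs arbitrary: q)
  case (Cons r rs)
  have n: "n > 0" using Cons.prems(2) by (cases n) auto
  show ?case
  proof (cases "q < n")
    case True
    then show ?thesis using Cons.prems by (simp add: nth_append)
  next
    case False
    then have "q - n < length rs * n" using Cons.prems by simp
    moreover have "q div n = Suc ((q - n) div n)" "q mod n = (q - n) mod n"
      using False n by (simp_all add: le_div_geq le_mod_geq)
    ultimately show ?thesis using False Cons by (simp add: nth_append)
  qed
qed simp

lemma length_concat_equal_lengths:
  "(\<And>r. r \<in> set rs \<Longrightarrow> length (f r) = n) \<Longrightarrow> length (concat (map f rs)) = length rs * n"
  by (induction rs) auto

section \<open>The Fourier factorization and the residue matrix\<close>

definition twisted :: "nat \<Rightarrow> 'a :: field \<Rightarrow> 'a list \<Rightarrow> 'a list" where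
  "twisted t w xs = concat (map (\<lambda>k. map (\<lambda>x. w ^ k * x) xs) [0..<t])"

lemma length_twisted: "length (twisted t w xs) = t * length xs"
  unfolding twisted_def by (subst length_concat_equal_lengths[where n = "length xs"]) auto

lemma twisted_nth:
  assumes "i < t * length xs"
  shows "twisted t w xs ! i = w ^ (i div length xs) * xs ! (i mod length xs)"
proof -
  have "i div length xs < t" "length xs > 0"
    using assms by (cases "length xs = 0"; simp add: div_less_iff_less_mult)+
  then show ?thesis
    unfolding twisted_def using assms by (subst nth_concat_equal_lengths[where n = "length xs"]) auto
qed

text \<open>The tensor product of the t x t Fourier matrix with the n x n identity, extended by a
  single 1 for the variable 1.\<close>

definition twist_matrix :: "nat \<Rightarrow> 'a :: field \<Rightarrow> nat \<Rightarrow> 'a mat" where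
  "twist_matrix t w n = mat (t * n + 1) (t * n + 1) (\<lambda>(i, i').
     if i < t * n \<and> i' < t * n
     then (if i mod n = i' mod n then w ^ ((i div n) * (i' div n)) else 0)
     else if i = i' then 1 else 0)"

text \<open>The exponents \<open>b\<close> are an arbitrary function of the column, so that the
  matrix can be formed for the beta list in its own order as well as sorted by residue. The last row
  belongs to the variable 1.\<close>

definition residue_matrix :: "nat \<Rightarrow> 'a :: field list \<Rightarrow> (nat \<Rightarrow> nat) \<Rightarrow> 'a mat" where
  "residue_matrix t xs b = mat (t * length xs + 1) (t * length xs + 1) (\<lambda>(i, j).
     if i < t * length xs
     then (if b j mod t = i div length xs then (xs ! (i mod length xs)) ^ b j else 0)
     else 1)"

text \<open>Since w^t = 1, the entry (w^k x)^b equals w^(k (b mod t)) x^b: a Fourier coefficient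
  times an entry of the residue matrix.\<close>

lemma twisted_matrix_factorization:
  fixes w :: "'a :: field"
  assumes w: "w ^ t = 1" and t: "t > 0" and n: "n = length xs" "n > 0"
  shows "mat (t * n + 1) (t * n + 1) (\<lambda>(i, j). ((twisted t w xs @ [1]) ! i) ^ b j) =
    twist_matrix t w n * residue_matrix t xs b" (is "?A = ?W * ?B")
proof (rule eq_matI)
  let ?m = "t * n + 1"
  fix i j assume "i < dim_row (?W * ?B)" "j < dim_col (?W * ?B)"
  then have i: "i < ?m" and j: "j < ?m" using n by (auto simp: twist_matrix_def residue_matrix_def)
  have prod: "(?W * ?B) $$ (i, j) = (\<Sum>k<?m. ?W $$ (i, k) * ?B $$ (k, j))"
    using i j n by (auto simp: twist_matrix_def residue_matrix_def scalar_prod_def atLeast0LessThan intro!: sum.cong)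
  show "?A $$ (i, j) = (?W * ?B) $$ (i, j)"
  proof (cases "i < t * n")
    case True
    \<comment> \<open>The only row of the right factor that contributes: the block of the residue of
      \<open>b j\<close>, with the same variable as row \<open>i\<close>.\<close>
    define k0 where "k0 = (b j mod t) * n + i mod n"
    have "b j mod t < t" using t by simp
    then have "Suc (b j mod t) * n \<le> t * n" by (intro mult_le_mono1) simp
    moreover have "i mod n < n" using n by simp
    ultimately have k0: "k0 < t * n" unfolding k0_def by simp
    have k0': "k0 div n = b j mod t" "k0 mod n = i mod n" using n(2) by (auto simp: k0_def)
    have "(\<Sum>k<?m. ?W $$ (i, k) * ?B $$ (k, j)) =
      (\<Sum>k<?m. if k = k0 then w ^ ((i div n) * (b j mod t)) * (xs ! (i mod n)) ^ b j else 0)"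
    proof (intro sum.cong refl)
      fix k assume k: "k \<in> {..<?m}"
      have W: "?W $$ (i, k) = (if k < t * n \<and> i mod n = k mod n then w ^ ((i div n) * (k div n)) else 0)"
        using True i k by (simp add: twist_matrix_def)
      have B: "?B $$ (k, j) = (if k < t * n then if b j mod t = k div n then (xs ! (k mod n)) ^ b j else 0 else 1)"
        using j k unfolding residue_matrix_def n(1)[symmetric] by simp
      show "?W $$ (i, k) * ?B $$ (k, j) =
        (if k = k0 then w ^ ((i div n) * (b j mod t)) * (xs ! (i mod n)) ^ b j else 0)"
      proof (cases "k = k0")
        case True
        then show ?thesis unfolding W B using k0 k0' by simp
      next
        case False
        then have "k div n \<noteq> b j mod t \<or> k mod n \<noteq> i mod n"
          unfolding k0_def by (metis div_mult_mod_eq)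
        with False show ?thesis unfolding W B by auto
      qed
    qed
    also have "\<dots> = w ^ ((i div n) * (b j mod t)) * (xs ! (i mod n)) ^ b j" using k0 by simp
    also have "w ^ ((i div n) * (b j mod t)) = (w ^ (i div n)) ^ b j"
    proof -
      have "w ^ b j = w ^ (t * (b j div t) + b j mod t)" by simp
      also have "\<dots> = w ^ (b j mod t)" unfolding power_add power_mult using w by simp
      finally show ?thesis by (metis power_mult mult.commute)
    qed
    finally show ?thesis
      using True i j n(1) unfolding prod
      by (simp add: nth_append length_twisted twisted_nth power_mult_distrib)
  next
    case False
    then have i: "i = t * n" using i by simp
    have "(\<Sum>k<?m. ?W $$ (i, k) * ?B $$ (k, j)) = (\<Sum>k<?m. if k = i then 1 else 0)"
      using i j n(1) by (intro sum.cong) (auto simp: twist_matrix_def residue_matrix_def)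
    then show ?thesis
      using i j n(1) unfolding prod by (simp add: nth_append length_twisted)
  qed
qed (auto simp: twist_matrix_def residue_matrix_def n)

text \<open>The n rows of block r are supported on fewer than n columns. By the pigeonhole principle
  every term of the Leibniz formula contains a zero entry.\<close>

lemma det_residue_matrix_eq_0:
  assumes n: "n = length xs" and r: "r < t" and few: "card {j. j < t * n + 1 \<and> b j mod t = r} < n"
  shows "det (residue_matrix t xs b) = 0"
proof -
  let ?m = "t * n + 1"
  have M: "residue_matrix t xs b \<in> carrier_mat ?m ?m" by (simp add: residue_matrix_def n)
  have rn: "r * n + n \<le> t * n" using mult_le_mono1[of "Suc r" t n] r by simp
  have "(\<Prod>i = 0..<?m. residue_matrix t xs b $$ (i, p i)) = 0" if p: "p permutes {0..<?m}" for p
  proof -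
    have plt: "p i < ?m" if "i < ?m" for i using permutes_in_image[OF p, of i] that by simp
    have "\<exists>i\<in>{r * n..<r * n + n}. b (p i) mod t \<noteq> r"
    proof (rule ccontr)
      assume "\<not> ?thesis"
      then have "p ` {r * n..<r * n + n} \<subseteq> {j. j < ?m \<and> b j mod t = r}"
        using plt rn by auto
      then have "card (p ` {r * n..<r * n + n}) \<le> card {j. j < ?m \<and> b j mod t = r}"
        by (intro card_mono) auto
      then show False using few permutes_inj_on[OF p] by (simp add: card_image)
    qed
    then obtain i where i: "r * n \<le> i" "i < r * n + n" "b (p i) mod t \<noteq> r" by auto
    then have "i div n = r"
      using few by (intro div_nat_eqI) (auto simp: mult.commute)
    with i have "residue_matrix t xs b $$ (i, p i) = 0"
      using plt[of i] rn n by (simp add: residue_matrix_def)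
    then show ?thesis using i rn by (intro prod_zero) (auto intro!: bexI[of _ i])
  qed
  then show ?thesis unfolding det_def'[OF M] by (intro sum.neutral ballI) (metis mem_Collect_eq mult_zero_right)
qed

lemma filter_neq_upt:
  assumes "c < t"
  shows "filter (\<lambda>i. i \<noteq> c) [0..<t] = map (\<lambda>q. if q < c then q else Suc q) [0..<t - 1]"
proof -
  have "[0..<t] = [0..<c] @ c # [Suc c..<t]"
    using assms upt_add_eq_append[of 0 c "t - c"] by (simp add: upt_conv_Cons)
  moreover have "filter (\<lambda>i. i \<noteq> c) [0..<c] = [0..<c]" "filter (\<lambda>i. i \<noteq> c) [Suc c..<t] = [Suc c..<t]"
    by (auto simp: filter_id_conv)
  ultimately have "filter (\<lambda>i. i \<noteq> c) [0..<t] = [0..<c] @ [Suc c..<t]" by simp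
  also have "\<dots> = map (\<lambda>q. if q < c then q else Suc q) [0..<t - 1]"
    using assms by (intro nth_equalityI) (auto simp: nth_append)
  finally show ?thesis .
qed

text \<open>Moving the rows of class c and the row of ones to the top makes the matrix block
  triangular. The sign records these moves; the blocks are indexed by the residues in the order in
  which the columns are listed.\<close>

lemma det_residue_matrix_sorted:
  fixes xs :: "'a :: field list"
  assumes n: "n = length xs" "n > 0" and c: "c < t"
    and rs: "rs = filter (\<lambda>i. i \<noteq> c) [0..<t]"
    and lenc: "length (Lf c) = n + 1" and lenr: "\<And>r. r \<in> set rs \<Longrightarrow> length (Lf r) = n"
    and res: "\<And>r b. b \<in> set (Lf r) \<Longrightarrow> b mod t = r"
    and L: "L = concat (map Lf (c # rs))"
  shows "det (residue_matrix t xs (\<lambda>j. L ! j)) =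
    (-1) ^ (t * n + (c * n + 1) * n) *
    det (mat (n + 1) (n + 1) (\<lambda>(i, j). ((xs @ [1]) ! i) ^ (Lf c ! j))) *
    (\<Prod>q<t - 1. det (mat n n (\<lambda>(i, j). (xs ! i) ^ (Lf (rs ! q) ! j))))"
proof -
  define m where "m = t * n + 1"
  define s where "s = t - 1"
  define B where "B = residue_matrix t xs (\<lambda>j. L ! j)"
  have B: "B \<in> carrier_mat m m" by (simp add: B_def residue_matrix_def m_def n)
  have "t = Suc s" using c by (simp add: s_def)
  then have m: "m = (n + 1) + s * n" by (simp add: m_def)
  have cn: "c * n + n \<le> t * n" using mult_le_mono1[of "Suc c" t n] c by simp
  have rs_map: "rs = map (\<lambda>q. if q < c then q else Suc q) [0..<s]"
    unfolding rs s_def by (rule filter_neq_upt[OF c])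
  have len_rs: "length rs = s" by (simp add: rs_map)
  have rs_nth: "rs ! q = (if q < c then q else Suc q)" if "q < s" for q using that by (simp add: rs_map)
  \<comment> \<open>First the row of ones moves up past t * n rows. Then the n rows of block c move
    up past c * n + 1 rows, the one extra being the row of ones, which so becomes row n.\<close>
  define B1 where "B1 = mat m m (\<lambda>(i, j). B $$ (if i < 1 then i + t * n else if i < t * n + 1 then i - 1 else i, j))"
  define B2 where "B2 = mat m m (\<lambda>(i, j). B1 $$ (if i < n then i + (c * n + 1) else if i < c * n + 1 + n then i - n else i, j))"
  have "det B = (-1) ^ (t * n * 1) * det B1"
    unfolding B1_def by (rule det_swap_initial_rows[OF B]) (simp add: m_def)
  also have "det B1 = (-1) ^ ((c * n + 1) * n) * det B2"
    unfolding B2_def by (rule det_swap_initial_rows) (use cn in \<open>auto simp: B1_def m_def\<close>)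
  finally have detB: "det B = (-1) ^ (t * n + (c * n + 1) * n) * det B2"
    by (simp add: power_add)
  define P where "P = mat (n + 1) (n + 1) (\<lambda>(i, j). ((xs @ [1]) ! i) ^ (Lf c ! j))"
  \<comment> \<open>The row of ones meets every column, so the upper right block is not zero; only
    the lower left one is.\<close>
  define Q where "Q = mat (n + 1) (s * n) (\<lambda>(i, j). B2 $$ (i, j + (n + 1)))"
  define F where "F = (\<lambda>q i j. (xs ! i) ^ (Lf (rs ! q) ! j))"
  define C where "C = mat (s * n) (s * n) (\<lambda>(i, j). if i div n = j div n then F (i div n) (i mod n) (j mod n) else 0)"
  have L_left: "L ! j = Lf c ! j" "Lf c ! j mod t = c" if "j < n + 1" for j
    using that lenc res[of "Lf c ! j" c] by (auto simp: L nth_append)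
  have L_right: "L ! (j + (n + 1)) = Lf (rs ! (j div n)) ! (j mod n)"
    "Lf (rs ! (j div n)) ! (j mod n) mod t = rs ! (j div n)" if "j < s * n" for j
  proof -
    have "L ! (j + (n + 1)) = concat (map Lf rs) ! j" using lenc by (simp add: L nth_append)
    also have "\<dots> = Lf (rs ! (j div n)) ! (j mod n)"
      by (rule nth_concat_equal_lengths) (use that lenr len_rs in auto)
    finally show "L ! (j + (n + 1)) = Lf (rs ! (j div n)) ! (j mod n)" .
    have "j div n < s" using that n(2) by (simp add: div_less_iff_less_mult)
    then have "length (Lf (rs ! (j div n))) = n" using len_rs by (intro lenr) simp
    then show "Lf (rs ! (j div n)) ! (j mod n) mod t = rs ! (j div n)"
      using n(2) by (intro res nth_mem) simp
  qed
  have B2_top: "B2 $$ (i, j) = (if L ! j mod t = c then (xs ! i) ^ (L ! j) else 0)" if "i < n" "j < m" for i j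
  proof -
    have "i < m" "i + (c * n + 1) < m" "i + c * n < t * n" using that cn by (auto simp: m_def)
    moreover have "(i + c * n) div n = c" "(i + c * n) mod n = i" using that by auto
    ultimately show ?thesis
      using that n(1) by (simp add: B2_def B1_def B_def residue_matrix_def m_def)
  qed
  have B2_mid: "B2 $$ (n, j) = 1" if "j < m" for j
    using that n(1) m by (simp add: B2_def B1_def B_def residue_matrix_def m_def)
  have B2_bot: "B2 $$ (i + (n + 1), j) =
      (if L ! j mod t = rs ! (i div n) then (xs ! (i mod n)) ^ (L ! j) else 0)" if "i < s * n" "j < m" for i j
  proof -
    have q: "i div n < s" using that n(2) by (simp add: div_less_iff_less_mult)
    have im: "i + (n + 1) < m" using that m by simp
    have iff: "i div n < c \<longleftrightarrow> i < c * n" using n(2) by (simp add: div_less_iff_less_mult)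
    \<comment> \<open>The remaining rows keep their order and skip the n rows of block c.\<close>
    have "B2 $$ (i + (n + 1), j) = B $$ (if i < c * n then i else i + n, j)"
      using im that(2) by (auto simp: B2_def B1_def m_def)
    also have "\<dots> = (if L ! j mod t = rs ! (i div n) then (xs ! (i mod n)) ^ (L ! j) else 0)"
      using that q im iff n rs_nth[OF q] by (auto simp: B_def residue_matrix_def m_def)
    finally show ?thesis .
  qed
  have blocks: "B2 = four_block_mat P Q (0\<^sub>m (s * n) (n + 1)) C"
  proof (rule eq_matI)
    fix i j assume "i < dim_row (four_block_mat P Q (0\<^sub>m (s * n) (n + 1)) C)"
      "j < dim_col (four_block_mat P Q (0\<^sub>m (s * n) (n + 1)) C)"
    then have i: "i < m" and j: "j < m" using m by (auto simp: P_def C_def)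
    consider "i < n" "j < n + 1" | "i = n" "j < n + 1" | "i < n + 1" "\<not> j < n + 1"
      | i' where "i = i' + (n + 1)" "i' < s * n" "j < n + 1"
      | i' j' where "i = i' + (n + 1)" "i' < s * n" "j = j' + (n + 1)" "j' < s * n"
    proof -
      have "i = (i - (n + 1)) + (n + 1) \<and> i - (n + 1) < s * n" if "\<not> i < n + 1" using that i m by simp
      moreover have "j = (j - (n + 1)) + (n + 1) \<and> j - (n + 1) < s * n"
        if "\<not> j < n + 1" using that j m by simp
      ultimately show ?thesis using that by (metis less_Suc_eq Suc_eq_plus1)
    qed
    then show "B2 $$ (i, j) = four_block_mat P Q (0\<^sub>m (s * n) (n + 1)) C $$ (i, j)"
    proof cases
      case 1
      then show ?thesis using i j n(1) L_left[of j] B2_top[of i j]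
        by (simp add: P_def C_def nth_append)
    next
      case 2
      then show ?thesis using i j n(1) B2_mid[of j] by (simp add: P_def C_def nth_append)
    next
      case 3
      then show ?thesis using i j m by (simp add: P_def C_def Q_def)
    next
      case (4 i')
      then have "i' div n < s" using n(2) by (simp add: div_less_iff_less_mult)
      then have "rs ! (i' div n) \<noteq> c" by (simp add: rs_nth)
      then show ?thesis using 4 j L_left[of j] B2_bot[of i' j]
        by (simp add: P_def C_def)
    next
      case (5 i' j')
      then have q: "i' div n < s" "j' div n < s" using n(2) by (simp_all add: div_less_iff_less_mult)
      then have "rs ! (j' div n) = rs ! (i' div n) \<longleftrightarrow> i' div n = j' div n"
        by (auto simp: rs_nth)
      then show ?thesis using 5 j L_right[of j'] B2_bot[of i' j]
        by (simp add: P_def C_def F_def)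
    qed
  qed (use m in \<open>auto simp: B2_def P_def C_def\<close>)
  have "det B2 = det P * det C"
    unfolding blocks by (rule det_four_block_mat_lower_left_zero) (auto simp: P_def Q_def C_def)
  also have "det C = (\<Prod>q<s. det (mat n n (\<lambda>(i, j). F q i j)))"
    unfolding C_def by (rule det_block_diagonal[OF n(2)])
  finally show ?thesis using detB unfolding B_def P_def F_def s_def by simp
qed

section \<open>Residue classes and the alternants of the quotient\<close>

lemma det_scale_rows:
  fixes A :: "'a :: comm_ring_1 mat"
  assumes "A \<in> carrier_mat N N"
  shows "det (mat N N (\<lambda>(i, j). d i * A $$ (i, j))) = (\<Prod>i<N. d i) * det A"
proof -
  have "(\<Prod>i = 0..<N. mat N N (\<lambda>(i, j). d i * A $$ (i, j)) $$ (i, p i)) =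
    (\<Prod>i<N. d i) * (\<Prod>i = 0..<N. A $$ (i, p i))" if p: "p permutes {0..<N}" for p
  proof -
    have "p i < N" if "i < N" for i using permutes_in_image[OF p, of i] that by simp
    then show ?thesis
      unfolding atLeast0LessThan prod.distrib[symmetric] by (intro prod.cong) auto
  qed
  then show ?thesis
    unfolding det_def'[OF assms] det_def'[OF mat_carrier]
    by (simp add: sum_distrib_left mult.left_commute)
qed

text \<open>As y^(t e + r) = y^r (y^t)^e, each row releases a factor y^r and leaves a row in the
  variables y^t.\<close>

lemma det_powers_residue_class:
  fixes ys :: "'a :: field list"
  assumes "N = length ys" "\<And>j. j < N \<Longrightarrow> L ! j = t * e j + r"
  shows "det (mat N N (\<lambda>(i, j). (ys ! i) ^ (L ! j))) =
    (\<Prod>i<N. ys ! i) ^ r * det (mat N N (\<lambda>(i, j). (map (\<lambda>x. x ^ t) ys ! i) ^ e j))"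
proof -
  let ?A = "mat N N (\<lambda>(i, j). (map (\<lambda>x. x ^ t) ys ! i) ^ e j)"
  have "mat N N (\<lambda>(i, j). (ys ! i) ^ (L ! j)) = mat N N (\<lambda>(i, j). (ys ! i) ^ r * ?A $$ (i, j))"
    using assms by (intro eq_matI) (auto simp: power_add power_mult mult.commute)
  then show ?thesis
    using det_scale_rows[of ?A N "\<lambda>i. (ys ! i) ^ r"] by (simp add: prod_power_distrib)
qed

lemma beta_residue_mod: "b \<in> set (beta_residue t lam m r) \<Longrightarrow> b mod t = r"
  by (simp add: beta_residue_def)

text \<open>Distinct numbers of one class have distinct quotients, so going backwards from the end
  of the list the quotient grows by at least one per step. This is what prevents truncation in
  \<open>t_quotient\<close>.\<close>

lemma beta_residue_nth_div_ge:
  assumes "is_partition lam" "N = residue_count t lam m r" "d < N"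
  shows "d \<le> beta_residue t lam m r ! (N - 1 - d) div t"
  using assms(3)
proof (induction d)
  case (Suc d)
  let ?L = "beta_residue t lam m r"
  have len: "length ?L = N" using assms(2) by (simp add: residue_count_def)
  define a b where "a = ?L ! (N - 1 - Suc d)" and "b = ?L ! (N - 1 - d)"
  have "b < a"
    unfolding a_def b_def using Suc.prems len
    by (intro sorted_wrt_nth_less[OF beta_residue_decreasing[OF assms(1)]]) auto
  moreover have "a mod t = r" "b mod t = r"
    unfolding a_def b_def using Suc.prems len by (auto intro!: beta_residue_mod nth_mem)
  ultimately have "b div t \<noteq> a div t" by (metis div_mult_mod_eq less_irrefl)
  moreover have "b div t \<le> a div t" using \<open>b < a\<close> by (simp add: div_le_mono)
  ultimately show ?case using Suc unfolding a_def b_def by simp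
qed simp

lemma beta_residue_nth:
  assumes "is_partition lam" "N = residue_count t lam m r" "j < N"
  shows "beta_residue t lam m r ! j = t * (t_quotient t lam m r j + (N - 1 - j)) + r"
proof -
  let ?b = "beta_residue t lam m r ! j"
  have "?b mod t = r"
    using assms(2,3) by (intro beta_residue_mod[of _ t lam m r] nth_mem) (simp add: residue_count_def)
  then have "?b = t * (?b div t) + r" by (metis mult_div_mod_eq)
  moreover have "N - 1 - j \<le> ?b div t"
    using beta_residue_nth_div_ge[OF assms(1,2), of "N - 1 - j"] assms(3) by simp
  then have "?b div t = t_quotient t lam m r j + (N - 1 - j)"
    using assms(2,3) by (simp add: t_quotient_def)
  ultimately show ?thesis by simp
qed

text \<open>The quotients in each class of the empty partition are N - 1, ..., 0, a bare staircase.
  The denominator thus factors into Vandermonde determinants.\<close>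

lemma t_quotient_empty:
  assumes "r < t"
  shows "t_quotient t (one_row 0) (t * n + 1) r = (\<lambda>_. 0)"
proof
  fix j
  define N where "N = residue_count t (one_row 0) (t * n + 1) r"
  have N: "N = (if r = 0 then Suc n else n)" 
    unfolding N_def using assms by (intro residue_count_one_row) auto
  let ?L = "map (\<lambda>j. t * (N - 1 - j) + r) [0..<N]"
  have "beta_residue t (one_row 0) (t * n + 1) r = ?L"
  proof (rule decreasing_list_unique[OF beta_residue_decreasing[OF is_partition_one_row]])
    show "sorted_wrt (>) ?L" using assms by (auto simp: sorted_wrt_iff_nth_less)
    have "set (beta_residue t (one_row 0) (t * n + 1) r) =
      {b \<in> set (beta_set (one_row 0) (t * n + 1)). b mod t = r}" by (auto simp: beta_residue_def)
    also have "\<dots> = (\<lambda>q. t * q + r) ` {..<N}"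
    proof -
      have "0 < t" using assms by simp
      from mem_beta_set_one_row[OF this] have "{q. t * q + r \<in> set (beta_set (one_row 0) (t * n + 1))} = {..<N}"
        using assms by (auto simp: N)
      then show ?thesis by (simp add: mod_class_eq_image[OF assms])
    qed
    also have "{..<N} = (\<lambda>j. N - 1 - j) ` {..<N}"
    proof
      show "{..<N} \<subseteq> (\<lambda>j. N - 1 - j) ` {..<N}"
        by (rule subsetI, rule_tac x = "N - 1 - x" in image_eqI) auto
    qed auto
    also have "(\<lambda>q. t * q + r) ` (\<lambda>j. N - 1 - j) ` {..<N} = set ?L" by (auto simp: image_image)
    finally show "set (beta_residue t (one_row 0) (t * n + 1) r) = set ?L" .
  qed
  then show "t_quotient t (one_row 0) (t * n + 1) r j = 0"
    using assms unfolding t_quotient_def N_def[symmetric] by simp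
qed

section \<open>Alternants in the twisted variables\<close>

definition alternant :: "(nat \<Rightarrow> nat) \<Rightarrow> 'a :: field list \<Rightarrow> 'a" where
  "alternant mu ys = det (mat (length ys) (length ys) (\<lambda>(i, j). (ys ! i) ^ (mu j + (length ys - 1 - j))))"

lemma schur_eq_alternants: "schur mu ys = alternant mu ys / alternant (\<lambda>_. 0) ys"
  by (simp add: schur_def alternant_def Let_def)

lemma alternant_twisted:
  assumes "w ^ t = 1" "t > 0" "n = length xs" "n > 0"
  shows "alternant lam (twisted t w xs @ [1]) =
    det (twist_matrix t w n) * det (residue_matrix t xs (\<lambda>j. beta_set lam (t * n + 1) ! j))"
proof -
  let ?m = "t * n + 1"
  have len: "length (twisted t w xs @ [1]) = ?m" using assms(3) by (simp add: length_twisted)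
  have "alternant lam (twisted t w xs @ [1]) =
    det (mat ?m ?m (\<lambda>(i, j). ((twisted t w xs @ [1]) ! i) ^ (beta_set lam ?m ! j)))"
    unfolding alternant_def len by (intro arg_cong[of _ _ det] eq_matI) (auto simp: beta_set_nth)
  also have "\<dots> = det (twist_matrix t w n * residue_matrix t xs (\<lambda>j. beta_set lam ?m ! j))"
    by (simp only: twisted_matrix_factorization[OF assms])
  also have "\<dots> = det (twist_matrix t w n) * det (residue_matrix t xs (\<lambda>j. beta_set lam ?m ! j))"
    by (rule det_mult[of _ ?m]) (simp_all add: twist_matrix_def residue_matrix_def assms(3))
  finally show ?thesis .
qed

lemma alternant_twisted_eq_0:
  assumes "w ^ t = 1" "n = length xs" "r < t" "residue_count t lam (t * n + 1) r < n"
  shows "alternant lam (twisted t w xs @ [1]) = 0"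
proof -
  have "residue_count t lam (t * n + 1) r = card {j. j < t * n + 1 \<and> beta_set lam (t * n + 1) ! j mod t = r}"
    by (simp add: residue_count_def beta_residue_def length_filter_conv_card)
  then have "det (residue_matrix t xs (\<lambda>j. beta_set lam (t * n + 1) ! j)) = 0"
    using assms(2-4) by (intro det_residue_matrix_eq_0[of n xs r t]) simp_all
  then show ?thesis using assms by (subst alternant_twisted[of w t n]) auto
qed

lemma sum_residue_count:
  assumes "t > 0"
  shows "(\<Sum>r<t. residue_count t lam m r) = m"
proof -
  have "mset (concat (map (\<lambda>i. filter (\<lambda>b. b mod t = i) (beta_set lam m)) [0..<t])) = mset (beta_set lam m)"
    using assms by (intro mset_concat_residues) auto
  then have "length (concat (map (beta_residue t lam m) [0..<t])) = m"
    unfolding beta_residue_def using mset_eq_length by fastforce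
  then show ?thesis
    by (simp add: length_concat o_def residue_count_def sum_list_distinct_conv_sum_set atLeast0LessThan)
qed

text \<open>The t counts sum to t * n + 1. If none is below n, their excesses over n sum to 1, so
  exactly one class has one extra element.\<close>

lemma residue_counts_cases:
  assumes "t > 0"
  obtains r where "r < t" "residue_count t lam (t * n + 1) r < n"
  | c where "c < t" "\<forall>r<t. residue_count t lam (t * n + 1) r = (if r = c then Suc n else n)"
proof (cases "\<exists>r<t. residue_count t lam (t * n + 1) r < n")
  case False
  let ?d = "\<lambda>r. residue_count t lam (t * n + 1) r - n"
  have split: "residue_count t lam (t * n + 1) r = n + ?d r" if "r < t" for r
    using False that by auto
  have "(\<Sum>r<t. residue_count t lam (t * n + 1) r) = (\<Sum>r<t. n + ?d r)"
    by (intro sum.cong refl split) simp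
  then have "t * n + 1 = (\<Sum>r<t. n + ?d r)" by (simp only: sum_residue_count[OF assms])
  then have "t * n + 1 = t * n + sum ?d {..<t}"
    by (simp only: sum.distrib sum_constant card_lessThan of_nat_id)
  then have "sum ?d {..<t} = Suc 0" by linarith
  then obtain c where c: "c < t" "?d c = Suc 0" "\<forall>r<t. c \<noteq> r \<longrightarrow> ?d r = 0"
    by (subst (asm) sum_eq_Suc0_iff) auto
  have "residue_count t lam (t * n + 1) r = (if r = c then Suc n else n)" if "r < t" for r
    using split[OF that] c(2) c(3)[rule_format, OF that] by (cases "r = c") auto
  with c(1) show ?thesis using that(2) by blast
qed (use that in blast)

text \<open>The constant \<open>K\<close> is chosen before the partition and the class c. It is
  therefore shared by the numerator and by the denominator, where the partition is empty, and
  cancels in the quotient.\<close>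

lemma alternant_twisted_product:
  fixes xs :: "'a :: field list"
  assumes "w ^ t = 1" "t > 0" and n: "n = length xs" "n > 0"
  shows "\<exists>K. \<forall>lam c. is_partition lam \<longrightarrow> c < t \<longrightarrow>
    (\<forall>r<t. residue_count t lam (t * n + 1) r = (if r = c then Suc n else n)) \<longrightarrow>
    alternant lam (twisted t w xs @ [1]) =
      K * (of_int (sign (sort_perm t lam (t * n + 1) c)) * (-1) ^ (c * n)) *
      (alternant (t_quotient t lam (t * n + 1) c) (map (\<lambda>x. x ^ t) xs @ [1]) *
       (\<Prod>i\<in>{0..t - 1} - {c}. alternant (t_quotient t lam (t * n + 1) i) (map (\<lambda>x. x ^ t) xs)))"
proof -
  define m where "m = t * n + 1"
  define X where "X = (\<Prod>i<n. xs ! i)"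
  \<comment> \<open>Class i releases X^i, so the total exponent 0 + ... + (t - 1) does not depend on
    c. Of the sign of the row moves only the part without c is included.\<close>
  define K where "K = det (twist_matrix t w n) * (-1) ^ (t * n + n) * X ^ (\<Sum>i\<in>{0..t - 1}. i)"
  have "alternant lam (twisted t w xs @ [1]) =
      K * (of_int (sign (sort_perm t lam m c)) * (-1) ^ (c * n)) *
      (alternant (t_quotient t lam m c) (map (\<lambda>x. x ^ t) xs @ [1]) *
       (\<Prod>i\<in>{0..t - 1} - {c}. alternant (t_quotient t lam m i) (map (\<lambda>x. x ^ t) xs)))"
    if lam: "is_partition lam" and c: "c < t"
      and counts: "\<forall>r<t. residue_count t lam m r = (if r = c then Suc n else n)" for lam c
  proof -
    define p where "p = sort_perm t lam m c"
    define rs where "rs = filter (\<lambda>i. i \<noteq> c) [0..<t]"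
    define L where "L = concat (map (beta_residue t lam m) (c # rs))"
    let ?B = "residue_matrix t xs (\<lambda>j. beta_set lam m ! j)"
    note p = sort_perm_sorts[OF lam c, of m, folded p_def rs_def L_def]
    have Lnth: "L ! j = beta_set lam m ! p j" if "j < m" for j using that p(2)[symmetric] by simp
    have plt: "p j < m" if "j < m" for j using permutes_in_image[OF p(1), of j] that by simp
    have set_rs: "set rs = {0..t - 1} - {c}" using c by (auto simp: rs_def)
    have len: "length (beta_residue t lam m r) = (if r = c then Suc n else n)" if "r < t" for r
      using counts that by (simp add: residue_count_def)
    have "residue_matrix t xs (\<lambda>j. L ! j) = mat m m (\<lambda>(i, j). ?B $$ (i, p j))"
      using plt by (intro eq_matI) (auto simp: residue_matrix_def m_def n Lnth)
    then have "det (residue_matrix t xs (\<lambda>j. L ! j)) = of_int (sign p) * det ?B"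
      using p(1) by (simp only:) (rule det_permute_cols, simp_all add: residue_matrix_def m_def n)
    \<comment> \<open>A sign is its own inverse.\<close>
    then have "det ?B = of_int (sign p) * det (residue_matrix t xs (\<lambda>j. L ! j))"
      by (cases p rule: sign_cases) simp_all
    also have "det (residue_matrix t xs (\<lambda>j. L ! j)) =
      (-1) ^ (t * n + (c * n + 1) * n) *
      det (mat (n + 1) (n + 1) (\<lambda>(i, j). ((xs @ [1]) ! i) ^ (beta_residue t lam m c ! j))) *
      (\<Prod>q<t - 1. det (mat n n (\<lambda>(i, j). (xs ! i) ^ (beta_residue t lam m (rs ! q) ! j))))"
    proof (rule det_residue_matrix_sorted[OF n c rs_def _ _ _ L_def])
      show "length (beta_residue t lam m r) = n" if "r \<in> set rs" for r
        using that len[of r] c unfolding set_rs by auto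
    qed (use len[OF c] beta_residue_mod in auto)
    \<comment> \<open>The exponent c * n * n has the parity of c * n.\<close>
    also have "(-1) ^ (t * n + (c * n + 1) * n) = (-1) ^ (t * n + n) * ((-1) ^ (c * n) :: 'a)"
      by (simp add: minus_one_power_iff)
    also have "det (mat (n + 1) (n + 1) (\<lambda>(i, j). ((xs @ [1]) ! i) ^ (beta_residue t lam m c ! j))) =
      X ^ c * alternant (t_quotient t lam m c) (map (\<lambda>x. x ^ t) xs @ [1])"
    proof -
      have "(\<Prod>i<n + 1. (xs @ [1]) ! i) = X" by (simp add: X_def n nth_append)
      moreover have "beta_residue t lam m c ! j = t * (t_quotient t lam m c j + (n + 1 - 1 - j)) + c"
        if "j < n + 1" for j
        using that counts c by (intro beta_residue_nth[OF lam]) auto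
      ultimately show ?thesis
        using det_powers_residue_class[of "n + 1" "xs @ [1]" "beta_residue t lam m c" t "\<lambda>j. t_quotient t lam m c j + (n + 1 - 1 - j)" c]
        by (simp add: alternant_def n)
    qed
    also have "(\<Prod>q<t - 1. det (mat n n (\<lambda>(i, j). (xs ! i) ^ (beta_residue t lam m (rs ! q) ! j)))) =
      (\<Prod>i\<in>{0..t - 1} - {c}. det (mat n n (\<lambda>(k, j). (xs ! k) ^ (beta_residue t lam m i ! j))))"
    proof -
      have "distinct rs" by (simp add: rs_def)
      moreover have "length rs = t - 1" unfolding rs_def filter_neq_upt[OF c] by simp
      ultimately have "bij_betw ((!) rs) {..<t - 1} ({0..t - 1} - {c})"
        by (intro bij_betw_nth) (simp_all add: set_rs)
      then show ?thesis by (rule prod.reindex_bij_betw)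
    qed
    also have "\<dots> = (\<Prod>i\<in>{0..t - 1} - {c}. X ^ i * alternant (t_quotient t lam m i) (map (\<lambda>x. x ^ t) xs))"
    proof (intro prod.cong refl)
      fix r assume r: "r \<in> {0..t - 1} - {c}"
      then have "beta_residue t lam m r ! j = t * (t_quotient t lam m r j + (n - 1 - j)) + r" if "j < n" for j
        using that counts c by (intro beta_residue_nth[OF lam]) auto
      then show "det (mat n n (\<lambda>(k, j). (xs ! k) ^ (beta_residue t lam m r ! j))) =
        X ^ r * alternant (t_quotient t lam m r) (map (\<lambda>x. x ^ t) xs)"
        using det_powers_residue_class[of n xs "beta_residue t lam m r" t "\<lambda>j. t_quotient t lam m r j + (n - 1 - j)" r]
        by (simp add: alternant_def n X_def)
    qed
    also have "\<dots> = X ^ (\<Sum>i\<in>{0..t - 1} - {c}. i) *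
      (\<Prod>i\<in>{0..t - 1} - {c}. alternant (t_quotient t lam m i) (map (\<lambda>x. x ^ t) xs))"
      by (simp add: prod.distrib power_sum)
    finally have detB: "det ?B = of_int (sign p) * ((-1) ^ (t * n + n) * (-1) ^ (c * n) *
      (X ^ c * alternant (t_quotient t lam m c) (map (\<lambda>x. x ^ t) xs @ [1])) *
      (X ^ (\<Sum>i\<in>{0..t - 1} - {c}. i) *
      (\<Prod>i\<in>{0..t - 1} - {c}. alternant (t_quotient t lam m i) (map (\<lambda>x. x ^ t) xs))))" .
    have "(\<Sum>i\<in>{0..t - 1}. i) = c + (\<Sum>i\<in>{0..t - 1} - {c}. i)"
      using c by (intro sum.remove) auto
    then have "X ^ (\<Sum>i\<in>{0..t - 1}. i) = X ^ c * X ^ (\<Sum>i\<in>{0..t - 1} - {c}. i)"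
      by (simp add: power_add)
    then show ?thesis
      unfolding alternant_twisted[OF assms] m_def[symmetric] detB K_def p_def[symmetric]
      by (simp only: mult_ac)
  qed
  then show ?thesis unfolding m_def by blast
qed

theorem theorem2p7:
  fixes t n :: nat and \<omega> :: complex and lam :: "nat \<Rightarrow> nat"
  assumes "t \<ge> 2" and "n \<ge> 1"
    and "primitive_root_of_unity t \<omega>"
    and "is_partition lam" and "part_length lam \<le> t * n + 1"
  shows "(part_length (t_core t lam) > 1 \<longrightarrow>
            schur lam (twisted_indets t n \<omega> @ [1]) = 0) \<and>
         (\<forall>c. c \<le> t - 1 \<and> t_core t lam = one_row c \<longrightarrow>
            schur lam (twisted_indets t n \<omega> @ [1]) =
              (-1) powi (int ((t * (t - 1) div 2) * (n * (n + 1) div 2)) - int (c * n)) *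
              of_int (sign (sort_perm t lam (t * n + 1) c)) *
              schur (t_quotient t lam (t * n + 1) c) (map (\<lambda>x. x ^ t) (indets n) @ [1]) *
              (\<Prod>i\<in>{0..t - 1} - {c}.
                 schur (t_quotient t lam (t * n + 1) i) (map (\<lambda>x. x ^ t) (indets n))))"
proof -
  define m where "m = t * n + 1"
  define xs where "xs = indets n"
  define ys where "ys = twisted t (const \<omega>) xs @ [1]"
  define T where "T = (t * (t - 1) div 2) * (n * (n + 1) div 2)"
  have t: "t > 0" using assms(1) by simp
  have n: "n = length xs" "n > 0" using assms(2) by (simp_all add: xs_def indets_def)
  have w: "const \<omega> ^ t = 1"
    using assms(3) by (simp add: const_power primitive_root_of_unity_def) (simp add: const_def one_ratfun)
  have ys: "twisted_indets t n \<omega> @ [1] = ys"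
    by (simp add: ys_def xs_def twisted_indets_def twisted_def)
  have zero: "\<forall>i\<ge>m. lam i = 0" unfolding m_def using partition_eq_0[OF assms(4,5)] by blast
  note core = t_core_eq_one_row_iff[OF _ assms(4) zero[unfolded m_def], folded m_def]
  obtain K where K: "\<And>lam c. is_partition lam \<Longrightarrow> c < t \<Longrightarrow>
      \<forall>r<t. residue_count t lam m r = (if r = c then Suc n else n) \<Longrightarrow>
      alternant lam ys = K * (of_int (sign (sort_perm t lam m c)) * (-1) ^ (c * n)) *
      (alternant (t_quotient t lam m c) (map (\<lambda>x. x ^ t) xs @ [1]) *
       (\<Prod>i\<in>{0..t - 1} - {c}. alternant (t_quotient t lam m i) (map (\<lambda>x. x ^ t) xs)))"
    using alternant_twisted_product[OF w t n] unfolding ys_def m_def by blast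
  \<comment> \<open>The denominator is the alternant of the empty partition, whose core is the row
    of length 0; the product formula applies to it with c = 0.\<close>
  have empty: "(\<lambda>_. 0) = one_row 0" by (auto simp: one_row_def)
  have "alternant (\<lambda>_. 0) ys = K * (of_int (sign (sort_perm t (one_row 0) m 0)) * (-1) ^ (0 * n)) *
      (alternant (t_quotient t (one_row 0) m 0) (map (\<lambda>x. x ^ t) xs @ [1]) *
       (\<Prod>i\<in>{0..t - 1} - {0}. alternant (t_quotient t (one_row 0) m i) (map (\<lambda>x. x ^ t) xs)))"
    unfolding empty using t residue_count_one_row[of 0 t] unfolding m_def[symmetric]
    by (intro K is_partition_one_row) (auto simp: m_def)
  also have "sign (sort_perm t (one_row 0) m 0) = (-1) ^ T"
    unfolding m_def T_def by (rule sign_sort_perm_empty[OF t])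
  also have "(\<Prod>i\<in>{0..t - 1} - {0}. alternant (t_quotient t (one_row 0) m i) (map (\<lambda>x. x ^ t) xs)) =
    alternant (\<lambda>_. 0) (map (\<lambda>x. x ^ t) xs) ^ (t - 1)"
  proof -
    have "(\<Prod>i\<in>{0..t - 1} - {0}. alternant (t_quotient t (one_row 0) m i) (map (\<lambda>x. x ^ t) xs)) =
      (\<Prod>i\<in>{0..t - 1} - {0}. alternant (\<lambda>_. 0) (map (\<lambda>x. x ^ t) xs))"
      using t unfolding m_def by (intro prod.cong refl) (subst t_quotient_empty, auto)
    then show ?thesis by simp
  qed
  also have "t_quotient t (one_row 0) m 0 = (\<lambda>_. 0)" unfolding m_def by (rule t_quotient_empty[OF t])
  finally have den: "alternant (\<lambda>_. 0) ys = K * (-1) ^ T *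
      (alternant (\<lambda>_. 0) (map (\<lambda>x. x ^ t) xs @ [1]) * alternant (\<lambda>_. 0) (map (\<lambda>x. x ^ t) xs) ^ (t - 1))"
    by simp
  \<comment> \<open>Primitivity of \<open>\<omega>\<close> makes the variables distinct, so the
    Vandermonde determinant is nonzero, and with it its factor \<open>K\<close>.\<close>
  have "alternant (\<lambda>_. 0) ys \<noteq> 0"
    using schur_denominator_nonzero[OF distinct_twisted[OF assms(3), of n]] t
    unfolding ys by (simp add: alternant_def)
  with den have "K \<noteq> 0" by auto
  have "schur lam ys = 0" if long: "part_length (t_core t lam) > 1"
  proof -
    \<comment> \<open>If no class were short, the counts would be those of a one-row core, of length
      at most 1.\<close>
    obtain r where "r < t" "residue_count t lam (t * n + 1) r < n"
    proof (rule residue_counts_cases[OF t, of lam n])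
      fix c assume "c < t" "\<forall>r<t. residue_count t lam (t * n + 1) r = (if r = c then Suc n else n)"
      then have "t_core t lam = one_row c" using core[of c] by (simp add: m_def)
      with long part_length_one_row_le[of c] show thesis by simp
    qed
    then have "alternant lam ys = 0"
      unfolding ys_def by (intro alternant_twisted_eq_0[OF w n(1)])
    then show ?thesis by (simp add: schur_eq_alternants)
  qed
  moreover have "schur lam ys = (-1) powi (int T - int (c * n)) *
      of_int (sign (sort_perm t lam m c)) *
      schur (t_quotient t lam m c) (map (\<lambda>x. x ^ t) xs @ [1]) *
      (\<Prod>i\<in>{0..t - 1} - {c}. schur (t_quotient t lam m i) (map (\<lambda>x. x ^ t) xs))"
    if "c \<le> t - 1" "t_core t lam = one_row c" for c
  proof -
    have c: "c < t" using that(1) t by simp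
    define s :: ratfun where "s = of_int (sign (sort_perm t lam m c))"
    define Nc where "Nc = alternant (t_quotient t lam m c) (map (\<lambda>x. x ^ t) xs @ [1])"
    define N where "N = (\<Prod>i\<in>{0..t - 1} - {c}. alternant (t_quotient t lam m i) (map (\<lambda>x. x ^ t) xs))"
    define Vc where "Vc = alternant (\<lambda>_. 0) (map (\<lambda>x. x ^ t) xs @ [1])"
    define V where "V = alternant (\<lambda>_. 0) (map (\<lambda>x. x ^ t) xs) ^ (t - 1)"
    have num: "alternant lam ys = K * (s * (-1) ^ (c * n)) * (Nc * N)"
      using K[OF assms(4) c] core[OF c] that(2) unfolding s_def Nc_def N_def by blast
    \<comment> \<open>Whatever c is, t - 1 classes share the Vandermonde determinant in n variables.
      This matches the exponent in \<open>den\<close>, computed for c = 0.\<close>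
    have "card ({0..t - 1} - {c}) = t - 1" using c by simp
    then have prod: "(\<Prod>i\<in>{0..t - 1} - {c}. schur (t_quotient t lam m i) (map (\<lambda>x. x ^ t) xs)) = N / V"
      unfolding schur_eq_alternants prod_dividef N_def V_def by simp
    \<comment> \<open>The exponent is an integer and may be negative. Only its parity matters, so
      the difference may be replaced by a sum.\<close>
    have "(-1 :: ratfun) powi (int T - int (c * n)) = (-1) ^ T * (-1) ^ (c * n)"
      by (simp add: power_int_diff power_int_of_nat minus_one_power_iff)
    moreover have "schur lam ys = K * (s * (-1) ^ (c * n)) * (Nc * N) / (K * (-1) ^ T * (Vc * V))"
      unfolding schur_eq_alternants num den Vc_def V_def ..
    moreover have "\<dots> = (-1) ^ T * (-1) ^ (c * n) * s * (Nc / Vc) * (N / V)"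
      using \<open>K \<noteq> 0\<close> by (cases "even T") auto
    ultimately show ?thesis
      unfolding prod s_def[symmetric] by (simp only: schur_eq_alternants Nc_def[symmetric] Vc_def[symmetric])
  qed
  ultimately show ?thesis
    unfolding ys T_def m_def xs_def by blast
qed

end
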